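(* Let $G$ and $H$ be graphs. Then the following are equivalent: (1) $G\cong_{\mathcal{DNN}}H$. (2) $G$ and $H$ are equivalent, i.e. there is an isomorphism of coherent algebras $\phi:\mathcal A_G\to\mathcal A_H$ with $\phi(A_G)=A_H$. (3) $\vartheta'(G\diamond H)=|V_G|=|V_H|$. (4) The first level of the Lasserre hierarchy for isomorphism of $G$ and $H$ has a nonnegative solution.
   Context: Graphs are finite (nonempty), simple and undirected; $A_G$ is the adjacency matrix of $G$. For vertices $x,y$ of the same graph, $\mathrm{rel}(x,y)$ denotes their relationship: equal, adjacent, or distinct non-adjacent. $\mathcal{DNN}$ is the cone of positive semidefinite matrices with nonnegative real entries. $G\cong_{\mathcal{DNN}}H$ means: there is a matrix $M\in\mathcal{DNN}$ with rows and columns indexed by $V_G\times V_H$ such that $\sum_{h,h'\in V_H}M_{gh,g'h'}=1$ for all $g,g'\in V_G$; $\sum_{g,g'\in V_G}M_{gh,g'h'}=1$ for all $h,h'\in V_H$; and $M_{gh,g'h'}=0$ whenever $\mathrm{rel}(g,g')\neq\mathrm{rel}(h,h')$. A coherent algebra is a linear subspace of $\mathbb C^{n\times n}$ closed under matrix multiplication, Schur (entrywise) product $\bullet$ and conjugate transpose, and containing the identity and the all-ones matrix. $\mathcal A_G$ is the intersection of all coherent algebras containing $A_G$. An isomorphism of coherent algebras is a linear bijection preserving matrix product, Schur product and conjugate transpose. The graph isomorphism product $G\diamond H$ has vertex set $V_G\times V_H$ with $(g,h)\sim(g',h')$ iff $\mathrm{rel}(g,g')\neq\mathrm{rel}(h,h')$.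 Schrijver's theta function of a graph $F$ is $\vartheta'(F)=\sup\{\mathrm{Tr}(MJ): M\in\mathcal{DNN},\ \mathrm{Tr}(M)=1,\ M_{u,u'}=0\text{ if }u\sim u'\text{ in }F\}$, with $M$ indexed by $V_F$ and $J$ the all-ones matrix. The first level of the Lasserre hierarchy for isomorphism of $G$ and $H$ is the following system in real variables $y_S$, indexed by subsets $S\subseteq V_G\times V_H$ with $|S|\le2$: the matrix $M_1(y)$, with rows and columns indexed by the subsets of $V_G\times V_H$ of size at most $1$ and $(S,T)$ entry $y_{S\cup T}$, is positive semidefinite; $\sum_{h}y_{\{(g,h)\}}=1$ for all $g$; $\sum_g y_{\{(g,h)\}}=1$ for all $h$; $y_{\{(g,h),(g',h')\}}=0$ if $\mathrm{rel}(g,g')\ne\mathrm{rel}(h,h')$; $y_\emptyset=1$. A nonnegative solution is one with all $y_S\ge0$. *)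

theory Defs
  imports "HOL-Analysis.Analysis"
begin

section \<open>Graphs\<close>

text \<open>
  A graph is given by its adjacency relation on a finite type; the vertex set is the whole type
  (hence finite and nonempty), so matrices indexed by vertices are the library matrices.
\<close>

definition simple_graph :: "('a::finite \<Rightarrow> 'a \<Rightarrow> bool) \<Rightarrow> bool" where
  "simple_graph G \<longleftrightarrow> symp G \<and> irreflp G"

datatype relationship = Equal | Adjacent | Nonadjacent

definition rel :: "('a::finite \<Rightarrow> 'a \<Rightarrow> bool) \<Rightarrow> 'a \<Rightarrow> 'a \<Rightarrow> relationship" where
  "rel G x y = (if x = y then Equal else if G x y then Adjacent else Nonadjacent)"

definition adjacency_matrix :: "('a::finite \<Rightarrow> 'a \<Rightarrow> bool) \<Rightarrow> complex^'a^'a" where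
  "adjacency_matrix G = (\<chi> x y. if G x y then 1 else 0)"

definition iso_product ::
  "('a::finite \<Rightarrow> 'a \<Rightarrow> bool) \<Rightarrow> ('b::finite \<Rightarrow> 'b \<Rightarrow> bool) \<Rightarrow> 'a \<times> 'b \<Rightarrow> 'a \<times> 'b \<Rightarrow> bool" where
  "iso_product G H = (\<lambda>(g, h) (g', h'). rel G g g' \<noteq> rel H h h')"

section \<open>Doubly nonnegative matrices\<close>

definition all_ones :: "'k::one^'n^'m" where
  "all_ones = (\<chi> i j. 1)"

definition pos_semidef :: "real^'n^'n \<Rightarrow> bool" where
  "pos_semidef M \<longleftrightarrow> transpose M = M \<and> (\<forall>x. 0 \<le> x \<bullet> (M *v x))"

definition DNN :: "(real^'n^'n) set" where
  "DNN = {M. pos_semidef M \<and> (\<forall>i j. 0 \<le> M $ i $ j)}"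

definition dnn_isomorphic ::
  "('a::finite \<Rightarrow> 'a \<Rightarrow> bool) \<Rightarrow> ('b::finite \<Rightarrow> 'b \<Rightarrow> bool) \<Rightarrow> bool" where
  "dnn_isomorphic G H \<longleftrightarrow>
     (\<exists>M \<in> (DNN :: (real^('a \<times> 'b)^('a \<times> 'b)) set).
        (\<forall>g g'. (\<Sum>h\<in>UNIV. \<Sum>h'\<in>UNIV. M $ (g, h) $ (g', h')) = 1) \<and>
        (\<forall>h h'. (\<Sum>g\<in>UNIV. \<Sum>g'\<in>UNIV. M $ (g, h) $ (g', h')) = 1) \<and>
        (\<forall>g h g' h'. rel G g g' \<noteq> rel H h h' \<longrightarrow> M $ (g, h) $ (g', h') = 0))"

section \<open>Coherent algebras\<close>

definition schur_product :: "complex^'n^'n \<Rightarrow> complex^'n^'n \<Rightarrow> complex^'n^'n" where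
  "schur_product A B = (\<chi> i j. A $ i $ j * B $ i $ j)"

definition conj_transpose :: "complex^'n^'n \<Rightarrow> complex^'n^'n" where
  "conj_transpose A = map_matrix cnj (transpose A)"

text \<open>
  The constant \<open>subspace\<close> refers to real scalars; the complex vector space structure on
  matrices is given by entrywise multiplication with a complex scalar.
\<close>

abbreviation cscale :: "complex \<Rightarrow> complex^'n^'n \<Rightarrow> complex^'n^'n" where
  "cscale c A \<equiv> map_matrix ((*) c) A"

interpretation cmat: vector_space "cscale :: complex \<Rightarrow> complex^'n^'n \<Rightarrow> complex^'n^'n"
  by unfold_locales (simp_all add: vec_eq_iff algebra_simps)

definition coherent_algebra :: "(complex^'n^'n) set \<Rightarrow> bool" where
  "coherent_algebra \<A> \<longleftrightarrow>
     cmat.subspace \<A> \<and>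
     (\<forall>A\<in>\<A>. \<forall>B\<in>\<A>. A ** B \<in> \<A>) \<and>
     (\<forall>A\<in>\<A>. \<forall>B\<in>\<A>. schur_product A B \<in> \<A>) \<and>
     (\<forall>A\<in>\<A>. conj_transpose A \<in> \<A>) \<and>
     mat 1 \<in> \<A> \<and> all_ones \<in> \<A>"

definition coherent_algebra_of :: "('a::finite \<Rightarrow> 'a \<Rightarrow> bool) \<Rightarrow> (complex^'a^'a) set" where
  "coherent_algebra_of G = \<Inter>{\<A>. coherent_algebra \<A> \<and> adjacency_matrix G \<in> \<A>}"

text \<open>
  The map is a total function on matrices, but only its restriction to the first algebra is
  constrained.
\<close>

definition coherent_algebra_iso ::
  "(complex^'n^'n \<Rightarrow> complex^'m^'m) \<Rightarrow> (complex^'n^'n) set \<Rightarrow> (complex^'m^'m) set \<Rightarrow> bool" where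
  "coherent_algebra_iso \<phi> \<A> \<B> \<longleftrightarrow>
     bij_betw \<phi> \<A> \<B> \<and>
     (\<forall>A\<in>\<A>. \<forall>B\<in>\<A>. \<phi> (A + B) = \<phi> A + \<phi> B) \<and>
     (\<forall>c. \<forall>A\<in>\<A>. \<phi> (cscale c A) = cscale c (\<phi> A)) \<and>
     (\<forall>A\<in>\<A>. \<forall>B\<in>\<A>. \<phi> (A ** B) = \<phi> A ** \<phi> B) \<and>
     (\<forall>A\<in>\<A>. \<forall>B\<in>\<A>. \<phi> (schur_product A B) = schur_product (\<phi> A) (\<phi> B)) \<and>
     (\<forall>A\<in>\<A>. \<phi> (conj_transpose A) = conj_transpose (\<phi> A))"

definition graphs_equivalent ::
  "('a::finite \<Rightarrow> 'a \<Rightarrow> bool) \<Rightarrow> ('b::finite \<Rightarrow> 'b \<Rightarrow> bool) \<Rightarrow> bool" where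
  "graphs_equivalent G H \<longleftrightarrow>
     (\<exists>\<phi>. coherent_algebra_iso \<phi> (coherent_algebra_of G) (coherent_algebra_of H) \<and>
          \<phi> (adjacency_matrix G) = adjacency_matrix H)"

section \<open>Schrijver's theta function\<close>

definition theta_feasible :: "('v::finite \<Rightarrow> 'v \<Rightarrow> bool) \<Rightarrow> (real^'v^'v) set" where
  "theta_feasible F = {M \<in> DNN. trace M = 1 \<and> (\<forall>u u'. F u u' \<longrightarrow> M $ u $ u' = 0)}"

definition schrijver_theta :: "('v::finite \<Rightarrow> 'v \<Rightarrow> bool) \<Rightarrow> real" where
  "schrijver_theta F = (SUP M\<in>theta_feasible F. trace (M ** all_ones))"

text \<open>
  The supremum is a genuine one: the following two facts show that it is taken over a nonempty
  set that is bounded above.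
\<close>

lemma theta_feasible_nonempty:
  assumes "simple_graph (F :: 'v::finite \<Rightarrow> 'v \<Rightarrow> bool)"
  shows "theta_feasible F \<noteq> {}"
proof -
  obtain w :: 'v where True by simp
  define M :: "real^'v^'v" where "M = (\<chi> i j. if i = w \<and> j = w then 1 else 0)"
  have Mx: "M *v x = (\<chi> i. if i = w then x $ w else 0)" for x
    by (auto simp: M_def matrix_vector_mult_def vec_eq_iff if_distrib[of "\<lambda>c. c * _"] cong: if_cong)
  have "x \<bullet> (M *v x) = x $ w * x $ w" for x
    by (simp add: Mx inner_vec_def if_distrib cong: if_cong)
  moreover have "transpose M = M"
    by (auto simp: M_def transpose_def vec_eq_iff)
  moreover have "trace M = 1"
    by (simp add: trace_def M_def)
  moreover have "\<not> F w w"
    using assms by (auto simp: simple_graph_def irreflp_def)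
  ultimately have "M \<in> theta_feasible F"
    by (auto simp: theta_feasible_def DNN_def pos_semidef_def M_def)
  then show ?thesis by blast
qed

lemma theta_bdd_above:
  "bdd_above ((\<lambda>M. trace (M ** all_ones)) ` theta_feasible (F :: 'v::finite \<Rightarrow> 'v \<Rightarrow> bool))"
proof (rule bdd_aboveI2)
  fix M assume "M \<in> theta_feasible F"
  then have sym: "transpose M = M" and pos: "\<And>x. 0 \<le> x \<bullet> (M *v x)" and tr: "trace M = 1"
    by (auto simp: theta_feasible_def DNN_def pos_semidef_def)
  have entry: "axis i 1 \<bullet> (M *v axis j 1) = M $ i $ j" for i j
    by (simp add: inner_axis' matrix_vector_mult_basis column_def)
  have s: "M $ i $ j = M $ j $ i" for i j
    using sym by (metis transpose_def vec_lambda_beta)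
  have le: "2 * M $ i $ j \<le> M $ i $ i + M $ j $ j" for i j
    using pos[of "axis i 1 - axis j 1"] s[of i j]
    by (simp add: matrix_vector_mult_diff_distrib inner_diff_left inner_diff_right entry)
  have "trace (M ** all_ones) = (\<Sum>i\<in>UNIV. \<Sum>j\<in>UNIV. M $ i $ j)"
    by (simp add: trace_def matrix_matrix_mult_def all_ones_def)
  also have "\<dots> \<le> (\<Sum>i\<in>UNIV. \<Sum>j\<in>UNIV. (M $ i $ i + M $ j $ j) / 2)"
  proof (intro sum_mono)
    fix i j show "M $ i $ j \<le> (M $ i $ i + M $ j $ j) / 2"
      using le[of i j] by simp
  qed
  also have "\<dots> = real CARD('v) * trace M"
    by (simp add: trace_def sum.distrib sum_divide_distrib[symmetric] sum_distrib_left[symmetric])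
  finally show "trace (M ** all_ones) \<le> real CARD('v)"
    using tr by simp
qed

section \<open>First level of the Lasserre hierarchy\<close>

text \<open>
  The subsets of size at most 1 are exactly \<open>set_option None = {}\<close> and
  \<open>set_option (Some v) = {v}\<close>, so they are indexed without repetition by the option type.
\<close>

definition lasserre_matrix :: "('v::finite set \<Rightarrow> real) \<Rightarrow> real^('v option)^('v option)" where
  "lasserre_matrix y = (\<chi> s t. y (set_option s \<union> set_option t))"

text \<open>
  The function \<open>y\<close> is total on sets, but its values on sets with more than two elements
  are not constrained.
\<close>

definition lasserre_solution ::
  "('a::finite \<Rightarrow> 'a \<Rightarrow> bool) \<Rightarrow> ('b::finite \<Rightarrow> 'b \<Rightarrow> bool) \<Rightarrow> (('a \<times> 'b) set \<Rightarrow> real) \<Rightarrow> bool" where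
  "lasserre_solution G H y \<longleftrightarrow>
     pos_semidef (lasserre_matrix y) \<and>
     (\<forall>g. (\<Sum>h\<in>UNIV. y {(g, h)}) = 1) \<and>
     (\<forall>h. (\<Sum>g\<in>UNIV. y {(g, h)}) = 1) \<and>
     (\<forall>g h g' h'. rel G g g' \<noteq> rel H h h' \<longrightarrow> y {(g, h), (g', h')} = 0) \<and>
     y {} = 1"

definition nonneg_lasserre_solution ::
  "('a::finite \<Rightarrow> 'a \<Rightarrow> bool) \<Rightarrow> ('b::finite \<Rightarrow> 'b \<Rightarrow> bool) \<Rightarrow> (('a \<times> 'b) set \<Rightarrow> real) \<Rightarrow> bool" where
  "nonneg_lasserre_solution G H y \<longleftrightarrow>
     lasserre_solution G H y \<and> (\<forall>S. card S \<le> 2 \<longrightarrow> 0 \<le> y S)"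

end

theory Submission
  imports Defs
begin

text \<open>
  If a positive semidefinite matrix annihilates a vector in its quadratic form, it annihilates the
  vector itself. Applied to a matrix \<open>M\<close> witnessing \<open>G\<close> and \<open>H\<close> to be isomorphic over the
  doubly nonnegative matrices, this shows that pairs \<open>(X, Y)\<close> with \<open>X g g' = Y h h'\<close> on the support
  of \<open>M\<close> are intertwined by \<open>M\<close>, and hence that such pairs are closed under products. They form
  the graph of an isomorphism of coherent algebras. Conversely, an isomorphism \<open>\<phi>\<close> matches the
  classes of pairs of vertices not separated by the two algebras, and \<open>M\<close> is the matrix that is
  the reciprocal of the class size on matching pairs and zero elsewhere. It is positive semidefinite
  because it lies in a matrix algebra and has nonnegative trace pairing with all squares of
  symmetric elements of that algebra. The conditions on \<open>\<vartheta>'\<close> and on the Lasserre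
  hierarchy are equality cases of inequalities between block sums of positive semidefinite matrices.
\<close>

section \<open>Positive semidefinite matrices\<close>

lemma psd_entry_sym: "pos_semidef M \<Longrightarrow> M $ i $ j = M $ j $ i"
  by (simp add: pos_semidef_def transpose_def vec_eq_iff)

lemma sym_inner_commute:
  fixes M :: "real^'n^'n"
  assumes "transpose M = M"
  shows "x \<bullet> (M *v y) = y \<bullet> (M *v x)"
  by (metis assms dot_lmul_matrix inner_commute transpose_matrix_vector)

text \<open>With \<open>y = M *v c\<close>, the form at \<open>c - t y\<close> is
  \<open>t (t b - 2 a)\<close> with \<open>a = |y|^2\<close>. If \<open>a\<close> were positive,
  this would be negative for small positive \<open>t\<close>.\<close>

lemma psd_kernel:
  fixes M :: "real^'n^'n"
  assumes "pos_semidef M" and zero: "c \<bullet> (M *v c) = 0"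
  shows "M *v c = 0"
proof (rule ccontr)
  have sym: "transpose M = M" and pos: "\<And>x. 0 \<le> x \<bullet> (M *v x)"
    using assms by (auto simp: pos_semidef_def)
  define y where "y = M *v c"
  have zero': "c \<bullet> y = 0" using zero by (simp add: y_def)
  define a where "a = y \<bullet> y"
  define b where "b = y \<bullet> (M *v y)"
  assume "M *v c \<noteq> 0"
  then have "a > 0" by (simp add: a_def y_def)
  have "b \<ge> 0" using pos by (simp add: b_def)
  define t where "t = a / (b + 1)"
  have "0 \<le> (c - t *\<^sub>R y) \<bullet> (M *v (c - t *\<^sub>R y))" by (rule pos)
  also have "\<dots> = t * t * b - 2 * t * a"
    using sym_inner_commute[OF sym, of c y]
    by (simp add: matrix_vector_mult_diff_distrib matrix_vector_mult_scaleR inner_diff_left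
        inner_diff_right zero' a_def b_def algebra_simps flip: y_def)
  also have "\<dots> = t * (t * b - 2 * a)" by (simp add: algebra_simps)
  finally have "0 \<le> t * (t * b - 2 * a)" .
  moreover have "t > 0" using \<open>a > 0\<close> \<open>b \<ge> 0\<close> by (simp add: t_def)
  moreover have "t * b \<le> a" using \<open>a > 0\<close> \<open>b \<ge> 0\<close> by (simp add: t_def field_simps)
  ultimately show False using \<open>a > 0\<close> by (simp add: zero_le_mult_iff)
qed

definition indicator_vec :: "'n::finite set \<Rightarrow> real^'n" where
  "indicator_vec S = (\<chi> i. if i \<in> S then 1 else 0)"

lemma indicator_vec_inner: "indicator_vec S \<bullet> y = (\<Sum>i\<in>S. y $ i)"
  by (simp add: indicator_vec_def inner_vec_def if_distrib[of "\<lambda>c. c * _"] sum.If_cases cong: if_cong)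

lemma mult_indicator_vec: "(M *v indicator_vec S) $ i = (\<Sum>j\<in>S. M $ i $ j)"
  by (simp add: indicator_vec_def matrix_vector_mult_def if_distrib[of "\<lambda>c. _ * c"] sum.If_cases cong: if_cong)

lemma psd_block_form:
  fixes M :: "real^'n^'n"
  assumes "pos_semidef M"
  defines "c \<equiv> \<lambda>S T. indicator_vec S - indicator_vec T"
  shows "c S T \<bullet> (M *v c S T) =
    (\<Sum>i\<in>S. \<Sum>j\<in>S. M $ i $ j) + (\<Sum>i\<in>T. \<Sum>j\<in>T. M $ i $ j) - 2 * (\<Sum>i\<in>S. \<Sum>j\<in>T. M $ i $ j)"
proof -
  have "(\<Sum>i\<in>T. \<Sum>j\<in>S. M $ i $ j) = (\<Sum>i\<in>S. \<Sum>j\<in>T. M $ i $ j)"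
    by (subst sum.swap) (simp add: psd_entry_sym[OF assms(1)])
  then show ?thesis
    by (simp add: c_def matrix_vector_mult_diff_distrib inner_diff_left inner_diff_right
        indicator_vec_inner mult_indicator_vec)
qed

lemma psd_block_le:
  fixes M :: "real^'n^'n"
  assumes "pos_semidef M"
  shows "2 * (\<Sum>i\<in>S. \<Sum>j\<in>T. M $ i $ j) \<le>
    (\<Sum>i\<in>S. \<Sum>j\<in>S. M $ i $ j) + (\<Sum>i\<in>T. \<Sum>j\<in>T. M $ i $ j)"
proof -
  have "0 \<le> x \<bullet> (M *v x)" for x using assms by (simp add: pos_semidef_def)
  from this[of "indicator_vec S - indicator_vec T"] show ?thesis
    unfolding psd_block_form[OF assms] by linarith
qed

text \<open>Equality makes the quadratic form vanish at the difference of the two indicator vectors,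
  so \<open>psd_kernel\<close> puts that difference in the kernel; coordinate \<open>i\<close> is
  the claim. This is how equalities between block sums become equalities row by row.\<close>

lemma psd_block_eq:
  fixes M :: "real^'n^'n"
  assumes "pos_semidef M"
    and "2 * (\<Sum>i\<in>S. \<Sum>j\<in>T. M $ i $ j) =
      (\<Sum>i\<in>S. \<Sum>j\<in>S. M $ i $ j) + (\<Sum>i\<in>T. \<Sum>j\<in>T. M $ i $ j)"
  shows "(\<Sum>j\<in>S. M $ i $ j) = (\<Sum>j\<in>T. M $ i $ j)"
proof -
  have "M *v (indicator_vec S - indicator_vec T) = 0"
    using psd_block_form[OF assms(1), of S T] assms(2) by (intro psd_kernel[OF assms(1)]) simp
  then have "(M *v indicator_vec S) $ i = (M *v indicator_vec T) $ i"
    by (simp add: matrix_vector_mult_diff_distrib)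
  then show ?thesis by (simp add: mult_indicator_vec)
qed

text \<open>
  If the least eigenvalue \<open>\<mu>\<close> of \<open>M\<close> were negative, the resolvent \<open>W = (M - \<mu> + \<epsilon>)\<^sup>-\<^sup>1\<close>
  would lie in the finite-dimensional algebra \<open>S\<close>, and for small \<open>\<epsilon>\<close> the eigenvalue \<open>1/\<epsilon>\<close>
  of \<open>W\<close> would make the trace of \<open>M W\<^sup>2\<close> negative.
\<close>
lemma self_dual_psd:
  fixes M :: "real^'n^'n"
  assumes S: "subspace S" "\<And>A B. A \<in> S \<Longrightarrow> B \<in> S \<Longrightarrow> A ** B \<in> S" "mat 1 \<in> S"
    and M: "M \<in> S" "transpose M = M"
    and dual: "\<And>W. W \<in> S \<Longrightarrow> transpose W = W \<Longrightarrow> 0 \<le> trace (M ** (W ** W))"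
  shows "pos_semidef M"
proof (rule ccontr)
  assume "\<not> pos_semidef M"
  then obtain x where x: "x \<bullet> (M *v x) < 0"
    using M(2) by (auto simp: pos_semidef_def not_le)
  have "x \<noteq> 0" using x by auto
  obtain v where v: "norm v = 1" and vmin: "\<And>y. norm y = 1 \<Longrightarrow> v \<bullet> (M *v v) \<le> y \<bullet> (M *v y)"
  proof -
    have "axis undefined 1 \<in> sphere (0::real^'n) 1" by simp
    then have ne: "sphere (0::real^'n) 1 \<noteq> {}" by blast
    have "continuous_on (sphere 0 1) (\<lambda>y. y \<bullet> (M *v y))"
      by (intro continuous_intros)
    from continuous_attains_inf[OF compact_sphere ne this] show ?thesis
      using that by (auto simp: dist_norm)
  qed
  define \<mu> where "\<mu> = v \<bullet> (M *v v)"
  have ray: "\<mu> * (y \<bullet> y) \<le> y \<bullet> (M *v y)" for y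
  proof (cases "y = 0")
    case False
    have "\<mu> \<le> (y /\<^sub>R norm y) \<bullet> (M *v (y /\<^sub>R norm y))"
      unfolding \<mu>_def by (rule vmin) (simp add: False)
    also have "\<dots> = (y \<bullet> (M *v y)) / (y \<bullet> y)"
      by (simp add: matrix_vector_mult_scaleR dot_square_norm power2_eq_square field_simps)
    finally show ?thesis using False by (simp add: pos_le_divide_eq)
  qed auto
  have "\<mu> * (x \<bullet> x) < 0" using ray[of x] x by linarith
  then have neg: "\<mu> < 0" using \<open>x \<noteq> 0\<close> inner_ge_zero[of x] by (auto simp: mult_less_0_iff)
  have scal: "(c *\<^sub>R mat 1 :: real^'n^'n) *v y = c *\<^sub>R y" for c y
    by (metis matrix_vector_mul_lid scaleR_matrix_vector_assoc)
  have tscal: "transpose (c *\<^sub>R mat 1 :: real^'n^'n) = c *\<^sub>R mat 1" for c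
    by (simp add: transpose_def mat_def vec_eq_iff)
  have tadd: "transpose (A + B) = transpose A + transpose B" for A B :: "real^'n^'n"
    by (simp add: transpose_def vec_eq_iff)
  define N where "N = M + (-\<mu>) *\<^sub>R mat 1"
  have Nv: "N *v y = M *v y - \<mu> *\<^sub>R y" for y
    unfolding N_def matrix_vector_mult_add_rdistrib scal by simp
  have "pos_semidef N"
    unfolding pos_semidef_def
  proof (intro conjI allI)
    show "transpose N = N" by (simp only: N_def tadd tscal M(2))
    show "0 \<le> y \<bullet> (N *v y)" for y using ray[of y] by (simp add: Nv inner_diff_right)
  qed
  moreover have vv: "v \<bullet> v = 1" using v by (simp add: dot_square_norm)
  then have "v \<bullet> (N *v v) = 0" by (simp add: Nv inner_diff_right \<mu>_def)
  ultimately have Nv0: "N *v v = 0" by (rule psd_kernel)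
  \<comment> \<open>Chosen so that \<open>CARD('n) * \<epsilon> + \<mu> = 0\<close>: in the final
    estimate the bound on \<open>trace W\<close> then cancels against the term with \<mu>, and only
    \<open>- \<epsilon> / \<epsilon>^2\<close> is left.\<close>
  define \<epsilon> where "\<epsilon> = - \<mu> / real CARD('n)"
  have \<epsilon>: "\<epsilon> > 0" using neg unfolding \<epsilon>_def by (intro divide_pos_pos) simp_all
  define K where "K = N + \<epsilon> *\<^sub>R mat 1"
  have Kv: "K *v y = N *v y + \<epsilon> *\<^sub>R y" for y
    unfolding K_def matrix_vector_mult_add_rdistrib scal by simp
  have Kpos: "\<epsilon> * (y \<bullet> y) \<le> y \<bullet> (K *v y)" for y
    using ray[of y] by (simp add: Kv Nv inner_diff_right inner_add_right)
  have KS: "K \<in> S"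
    unfolding K_def N_def by (intro subspace_add[OF S(1)] subspace_scale[OF S(1)] S(3) M(1))
  have Kinj: "y = 0" if "K *v y = 0" for y
    using Kpos[of y] that \<epsilon> inner_ge_zero[of y] by (simp add: mult_le_0_iff)
  have Kinv: "\<exists>A. A ** K = mat 1"
    using Kinj by (simp add: matrix_left_invertible_ker)
  have lin: "linear (\<lambda>W. K ** W)"
    by (rule linearI)
      (simp_all add: vec_eq_iff matrix_matrix_mult_def sum.distrib sum_distrib_left algebra_simps)
  \<comment> \<open>Left multiplication by \<open>K\<close> maps \<open>S\<close> into itself
    injectively, hence onto by dimension. A preimage of the identity is an inverse of
    \<open>K\<close> inside \<open>S\<close>.\<close>
  have "inj_on (\<lambda>W. K ** W) S"
    by (metis Kinv inj_onI matrix_mul_assoc matrix_mul_lid)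
  then have "dim ((\<lambda>W. K ** W) ` S) = dim S"
    using S(1) by (intro dim_image_eq[OF lin]) (simp add: span_eq_iff[THEN iffD2])
  then have "(\<lambda>W. K ** W) ` S = S"
    using S KS by (intro subspace_dim_equal linear_subspace_image lin) auto
  then obtain W where W: "W \<in> S" "K ** W = mat 1"
    using S(3) by (metis (no_types, lifting) imageE)
  have WK: "W ** K = mat 1" using W(2) by (simp add: matrix_left_right_inverse)
  have Ksym: "transpose K = K" by (simp only: K_def N_def tadd tscal M(2))
  have "transpose W ** K = mat 1"
    by (metis Ksym W(2) matrix_transpose_mul transpose_mat)
  then have Wsym: "transpose W = W"
    by (metis W(2) matrix_mul_assoc matrix_mul_lid matrix_mul_rid)
  have MK: "M = K + (\<mu> - \<epsilon>) *\<^sub>R mat 1"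
    by (simp add: K_def N_def algebra_simps)
  have "M ** (W ** W) = W + (\<mu> - \<epsilon>) *\<^sub>R (W ** W)"
  proof -
    have "(K + c *\<^sub>R mat 1) ** B = K ** B + c *\<^sub>R B" for B c
      by (simp add: vec_eq_iff matrix_matrix_mult_def mat_def algebra_simps sum.distrib
          if_distrib[of "\<lambda>c. _ * c"] cong: if_cong)
    from this[of "\<mu> - \<epsilon>" "W ** W"] show ?thesis
      unfolding MK[symmetric] by (simp add: matrix_mul_assoc W(2))
  qed
  then have tr: "trace (M ** (W ** W)) = trace W + (\<mu> - \<epsilon>) * trace (W ** W)"
    by (simp add: trace_def sum.distrib sum_distrib_left)
  \<comment> \<open>For \<open>y = W *v axis i 1\<close>, coercivity of \<open>K\<close> gives
    \<open>\<epsilon> |y|^2 \<le> y $ i\<close>, while \<open>(y $ i)^2 \<le> |y|^2\<close>.\<close>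
  have "W $ i $ i \<le> 1 / \<epsilon>" for i
  proof -
    define y where "y = W *v axis i 1"
    have yi: "y $ i = W $ i $ i" by (simp add: y_def matrix_vector_mult_basis column_def)
    have "K *v y = axis i 1" unfolding y_def by (simp only: matrix_vector_mul_assoc W(2) matrix_vector_mul_lid)
    then have "\<epsilon> * (y \<bullet> y) \<le> y $ i" using Kpos[of y] by (simp add: inner_axis)
    moreover have "y $ i * y $ i \<le> y \<bullet> y"
      unfolding inner_vec_def by (auto intro!: member_le_sum[of i UNIV "\<lambda>i. y $ i * y $ i", simplified])
    ultimately have "\<epsilon> * (y $ i * y $ i) \<le> y $ i"
      using \<epsilon> by (meson mult_left_mono order_trans less_imp_le)
    then have "(\<epsilon> * y $ i) * y $ i \<le> 1 * y $ i" by (simp add: mult.assoc)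
    then have "\<epsilon> * y $ i \<le> 1 \<or> y $ i \<le> 0"
      by (metis mult_le_cancel_right not_le)
    then have "y $ i * \<epsilon> \<le> 1"
      using \<epsilon> by (smt (verit) mult.commute mult_nonneg_nonpos2)
    then show ?thesis unfolding yi using \<epsilon> by (simp add: pos_le_divide_eq)
  qed
  then have "trace W \<le> (\<Sum>i\<in>(UNIV::'n set). 1 / \<epsilon>)"
    unfolding trace_def by (intro sum_mono) auto
  then have trW: "trace W \<le> real CARD('n) / \<epsilon>" by simp
  have "W *v (K *v v) = v" by (simp only: matrix_vector_mul_assoc WK matrix_vector_mul_lid)
  then have "\<epsilon> *\<^sub>R (W *v v) = v"
    by (simp only: Kv Nv0 matrix_vector_mult_scaleR add_0)
  then have "(1 / \<epsilon>) *\<^sub>R (\<epsilon> *\<^sub>R (W *v v)) = (1 / \<epsilon>) *\<^sub>R v" by (rule arg_cong)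
  then have Wv: "W *v v = (1 / \<epsilon>) *\<^sub>R v" using \<epsilon> by simp
  \<comment> \<open>The squared Frobenius norm of \<open>W\<close> dominates \<open>|W v|^2\<close>
    for the unit vector \<open>v\<close>, by Cauchy-Schwarz on each row.\<close>
  have "1 / \<epsilon>\<^sup>2 = (W *v v) \<bullet> (W *v v)"
    by (simp add: Wv vv power2_eq_square)
  also have "\<dots> = (\<Sum>i\<in>UNIV. (row i W \<bullet> v)\<^sup>2)"
    by (simp add: inner_vec_def matrix_vector_mult_def row_def power2_eq_square)
  also have "\<dots> \<le> (\<Sum>i\<in>UNIV. row i W \<bullet> row i W)"
    using Cauchy_Schwarz_ineq[of _ v] by (intro sum_mono) (metis mult.right_neutral vv)
  also have "\<dots> = trace (W ** transpose W)"
    by (simp add: trace_def matrix_matrix_mult_def transpose_def inner_vec_def row_def)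
  finally have trWW: "1 / \<epsilon>\<^sup>2 \<le> trace (W ** W)" by (simp add: Wsym)
  have "0 \<le> trace W + (\<mu> - \<epsilon>) * trace (W ** W)"
    using dual[OF W(1) Wsym] by (simp add: tr)
  also have "\<dots> \<le> real CARD('n) / \<epsilon> + (\<mu> - \<epsilon>) * (1 / \<epsilon>\<^sup>2)"
    using trW trWW neg \<epsilon> by (intro add_mono mult_left_mono_neg) auto
  also have "\<dots> = (real CARD('n) * \<epsilon> + \<mu> - \<epsilon>) / \<epsilon>\<^sup>2"
    using \<epsilon> by (simp add: field_simps power2_eq_square)
  also have "\<dots> = - \<epsilon> / \<epsilon>\<^sup>2" by (simp add: \<epsilon>_def)
  finally show False using \<epsilon> by (simp add: field_simps)
qed

section \<open>Schrijver's theta function\<close>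

lemma trace_mult_all_ones:
  "trace (M ** all_ones) = (\<Sum>i\<in>UNIV. \<Sum>j\<in>UNIV. M $ i $ j)" for M :: "real^'n^'n"
  by (simp add: trace_def matrix_matrix_mult_def all_ones_def)

text \<open>A clique cover bound. Diagonal blocks reduce to their diagonals and so sum to the trace,
  which is 1. Summing \<open>2 b k l \<le> b k k + b l l\<close> over all \<open>k\<close>,
  \<open>l\<close> bounds the total; if the total is extremal, every one of these inequalities is an
  equality.\<close>

lemma theta_partition:
  fixes M :: "real^'v^'v" and \<pi> :: "'v::finite \<Rightarrow> 'k::finite"
  defines "b \<equiv> \<lambda>k l. \<Sum>u\<in>\<pi> -` {k}. \<Sum>v\<in>\<pi> -` {l}. M $ u $ v"
  assumes psd: "pos_semidef M" and tr: "trace M = 1"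
    and clique: "\<And>u v. \<pi> u = \<pi> v \<Longrightarrow> u \<noteq> v \<Longrightarrow> M $ u $ v = 0"
  shows "trace (M ** all_ones) \<le> real CARD('k)"
    and "trace (M ** all_ones) = real CARD('k) \<Longrightarrow> b k l = 1 / real CARD('k)"
proof -
  have fibre: "(\<Sum>k\<in>UNIV. \<Sum>u\<in>\<pi> -` {k}. f u) = sum f UNIV" for f :: "'v \<Rightarrow> real"
    using sum.group[of UNIV UNIV \<pi> f] by (simp add: vimage_def)
  have diag: "b k k = (\<Sum>u\<in>\<pi> -` {k}. M $ u $ u)" for k
    unfolding b_def
  proof (rule sum.cong[OF refl])
    fix u assume u: "u \<in> \<pi> -` {k}"
    have "(\<Sum>v\<in>\<pi> -` {k}. M $ u $ v) = (\<Sum>v\<in>\<pi> -` {k}. if v = u then M $ u $ u else 0)"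
      using u clique[of u] by (intro sum.cong) auto
    then show "(\<Sum>v\<in>\<pi> -` {k}. M $ u $ v) = M $ u $ u" using u by simp
  qed
  have sum_diag: "(\<Sum>k\<in>UNIV. b k k) = 1"
    unfolding diag fibre using tr by (simp add: trace_def)
  have "(\<Sum>k\<in>UNIV. \<Sum>l\<in>UNIV. b k l) = (\<Sum>k\<in>UNIV. \<Sum>u\<in>\<pi> -` {k}. \<Sum>l\<in>UNIV. \<Sum>v\<in>\<pi> -` {l}. M $ u $ v)"
    unfolding b_def by (intro sum.cong refl sum.swap)
  then have sum_all: "(\<Sum>k\<in>UNIV. \<Sum>l\<in>UNIV. b k l) = trace (M ** all_ones)"
    unfolding fibre trace_mult_all_ones .
  have nonneg: "0 \<le> b k k + b l l - 2 * b k l" for k l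
    using psd_block_le[OF psd, where S = "\<pi> -` {k}" and T = "\<pi> -` {l}"] by (simp add: b_def)
  have "(\<Sum>k\<in>UNIV. \<Sum>l\<in>UNIV. b k k + b l l - 2 * b k l) =
      (\<Sum>k\<in>(UNIV::'k set). \<Sum>l\<in>(UNIV::'k set). b k k) + (\<Sum>k\<in>(UNIV::'k set). \<Sum>l\<in>UNIV. b l l)
      - 2 * (\<Sum>k\<in>UNIV. \<Sum>l\<in>UNIV. b k l)"
    by (simp only: sum.distrib sum_subtractf sum_distrib_left)
  also have "\<dots> = 2 * real CARD('k) - 2 * trace (M ** all_ones)"
    by (simp add: sum_all sum_diag flip: sum_distrib_left)
  finally have total: "(\<Sum>k\<in>UNIV. \<Sum>l\<in>UNIV. b k k + b l l - 2 * b k l) =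
      2 * real CARD('k) - 2 * trace (M ** all_ones)" .
  have "0 \<le> (\<Sum>k\<in>UNIV. \<Sum>l\<in>UNIV. b k k + b l l - 2 * b k l)"
    by (intro sum_nonneg nonneg)
  then show "trace (M ** all_ones) \<le> real CARD('k)" unfolding total by simp
  assume eq: "trace (M ** all_ones) = real CARD('k)"
  have "(\<Sum>l\<in>UNIV. b k k + b l l - 2 * b k l) = 0" for k
  proof -
    have "(\<Sum>k\<in>UNIV. \<Sum>l\<in>UNIV. b k k + b l l - 2 * b k l) = 0" unfolding total eq by simp
    then have "\<forall>k\<in>UNIV. (\<Sum>l\<in>UNIV. b k k + b l l - 2 * b k l) = 0"
      by (subst (asm) sum_nonneg_eq_0_iff) (simp_all only: finite sum_nonneg nonneg)
    then show ?thesis by blast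
  qed
  then have "\<forall>l\<in>UNIV. b k k + b l l - 2 * b k l = 0" for k
    by (subst (asm) sum_nonneg_eq_0_iff) (simp_all only: finite nonneg)
  then have zero: "b k k + b l l - 2 * b k l = 0" for k l by blast
  \<comment> \<open>\<open>psd_block_eq\<close> equates the two fibre sums within each single row of
    \<open>M\<close>; summing over the rows in fibre \<open>m\<close> makes the block sums
    constant.\<close>
  have row: "b m k = b m l" for k l m
    unfolding b_def
    by (intro sum.cong refl psd_block_eq[OF psd]) (use zero[of k l] in \<open>simp add: b_def\<close>)
  have sym: "b k l = b l k" for k l
    unfolding b_def by (subst sum.swap) (simp add: psd_entry_sym[OF psd])
  have const: "b k' l' = b k l" for k' l'
    using row[of k' l' l] row[of l k' k] sym by simp
  have "real CARD('k) = (\<Sum>k'\<in>UNIV. \<Sum>l'\<in>UNIV. b k' l')" by (simp add: sum_all eq)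
  also have "\<dots> = real CARD('k) * (real CARD('k) * b k l)"
    by (subst const) simp
  finally show "b k l = 1 / real CARD('k)" by (simp add: field_simps)
qed

lemma norm_vec_le_sum: "norm x \<le> (\<Sum>i\<in>UNIV. norm (x $ i))"
  unfolding norm_vec_def by (intro L2_set_le_sum) simp

text \<open>Diagonal entries are at most the trace, which is 1, and positive semidefiniteness bounds
  the other entries by the diagonal ones. All constraints are closed.\<close>

lemma compact_theta_feasible: "compact (theta_feasible F)"
  for F :: "'v::finite \<Rightarrow> 'v \<Rightarrow> bool"
proof -
  have eq: "theta_feasible F = {M. \<forall>i j. M $ i $ j = M $ j $ i} \<inter> {M. \<forall>x. 0 \<le> x \<bullet> (M *v x)} \<inter>
      {M. \<forall>i j. 0 \<le> M $ i $ j} \<inter> {M. trace M = 1} \<inter> {M. \<forall>u v. F u v \<longrightarrow> M $ u $ v = 0}"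
    by (auto simp: theta_feasible_def DNN_def pos_semidef_def transpose_def vec_eq_iff)
  have "closed (theta_feasible F)"
    unfolding eq trace_def
    by (intro closed_Int closed_Collect_all closed_Collect_le closed_Collect_eq closed_Collect_imp
        open_Collect_const continuous_intros)
       (auto simp: matrix_vector_mult_def inner_vec_def intro!: continuous_intros)
  moreover have "bounded (theta_feasible F)"
    unfolding bounded_iff
  proof (intro exI ballI)
    fix M assume M: "M \<in> theta_feasible F"
    then have psd: "pos_semidef M" and nonneg: "\<And>i j. 0 \<le> M $ i $ j" and tr: "trace M = 1"
      by (auto simp: theta_feasible_def DNN_def)
    have d: "M $ i $ i \<le> 1" for i
      using member_le_sum[of i UNIV "\<lambda>i. M $ i $ i"] nonneg tr by (simp add: trace_def)
    have e: "norm (M $ i $ j) \<le> 1" for i j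
      using psd_block_le[OF psd, where S = "{i}" and T = "{j}"] d[of i] d[of j] nonneg[of i j] by simp
    have "norm M \<le> (\<Sum>i\<in>UNIV. norm (M $ i))" by (rule norm_vec_le_sum)
    also have "\<dots> \<le> (\<Sum>i\<in>(UNIV::'v set). real CARD('v))"
    proof (intro sum_mono)
      fix i
      have "norm (M $ i) \<le> (\<Sum>j\<in>UNIV. norm (M $ i $ j))" by (rule norm_vec_le_sum)
      also have "\<dots> \<le> (\<Sum>j\<in>(UNIV::'v set). 1)" by (intro sum_mono e)
      finally show "norm (M $ i) \<le> real CARD('v)" by simp
    qed
    finally show "norm M \<le> (\<Sum>i\<in>(UNIV::'v set). real CARD('v))" .
  qed
  ultimately show ?thesis by (simp add: compact_eq_bounded_closed)
qed

text \<open>The equality case of \<open>theta_partition\<close> speaks about a matrix, so a supremum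
  equal to the bound is of use only once it is a maximum.\<close>

lemma schrijver_theta_attained:
  fixes F :: "'v::finite \<Rightarrow> 'v \<Rightarrow> bool"
  assumes "simple_graph F"
  obtains M where "M \<in> theta_feasible F" "trace (M ** all_ones) = schrijver_theta F"
proof -
  have "continuous_on (theta_feasible F) (\<lambda>M. trace (M ** all_ones))"
    unfolding trace_mult_all_ones by (intro continuous_intros)
  from continuous_attains_sup[OF compact_theta_feasible theta_feasible_nonempty[OF assms] this]
  obtain M where M: "M \<in> theta_feasible F"
      "\<And>N. N \<in> theta_feasible F \<Longrightarrow> trace (N ** all_ones) \<le> trace (M ** all_ones)"
    by blast
  then have "schrijver_theta F = trace (M ** all_ones)"
    unfolding schrijver_theta_def by (intro cSup_eq_maximum) auto
  with M(1) show ?thesis using that by simp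
qed

section \<open>Fibres of the vertex set of the graph isomorphism product\<close>

lemma fst_vimage_singleton: "fst -` {g} = {g} \<times> UNIV"
  and snd_vimage_singleton: "snd -` {h} = UNIV \<times> {h}"
  by auto

lemma sum_fst_fibre: "(\<Sum>u\<in>{g} \<times> UNIV. f u) = (\<Sum>h\<in>UNIV. f (g, h))"
  for f :: "'a \<times> 'b::finite \<Rightarrow> 'c::comm_monoid_add"
  by (simp add: sum.cartesian_product')

lemma sum_snd_fibre: "(\<Sum>u\<in>UNIV \<times> {h}. f u) = (\<Sum>g\<in>UNIV. f (g, h))"
  for f :: "'a::finite \<times> 'b \<Rightarrow> 'c::comm_monoid_add"
  by (simp add: sum.cartesian_product')

lemma sum_pairs: "(\<Sum>u\<in>UNIV. f u) = (\<Sum>g\<in>UNIV. \<Sum>h\<in>UNIV. f (g, h))"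
  for f :: "'a::finite \<times> 'b::finite \<Rightarrow> 'c::comm_monoid_add"
  by (simp add: sum.cartesian_product' flip: UNIV_Times_UNIV)

lemma simple_graph_iso_product:
  assumes "simple_graph G" "simple_graph H"
  shows "simple_graph (iso_product G H)"
proof -
  have sym: "rel G x y = rel G y x" "rel H x' y' = rel H y' x'" for x y x' y'
    using assms by (auto simp: rel_def simple_graph_def symp_def)
  have refl: "rel G x x = rel H y y" for x y by (simp add: rel_def)
  show ?thesis
    unfolding simple_graph_def symp_def irreflp_def iso_product_def split_paired_All prod.case
    using sym refl by metis
qed

lemma rel_eq_iff: "rel G g g' = rel H h h' \<Longrightarrow> g = g' \<longleftrightarrow> h = h'"
  by (auto simp: rel_def split: if_splits)

section \<open>Row and column structure of a doubly nonnegative isomorphism matrix\<close>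

locale dnn_isomorphism =
  fixes G :: "'a::finite \<Rightarrow> 'a \<Rightarrow> bool" and H :: "'b::finite \<Rightarrow> 'b \<Rightarrow> bool"
    and M :: "real^('a \<times> 'b)^('a \<times> 'b)"
  assumes psd: "pos_semidef M"
    and nonneg: "0 \<le> M $ u $ v"
    and block_G: "(\<Sum>h\<in>UNIV. \<Sum>h'\<in>UNIV. M $ (g, h) $ (g', h')) = 1"
    and block_H: "(\<Sum>g\<in>UNIV. \<Sum>g'\<in>UNIV. M $ (g, h) $ (g', h')) = 1"
    and support: "rel G g g' \<noteq> rel H h h' \<Longrightarrow> M $ (g, h) $ (g', h') = 0"
begin

lemma sym: "M $ u $ v = M $ v $ u"
  by (rule psd_entry_sym[OF psd])

lemma support_eq: "(g = g') \<noteq> (h = h') \<Longrightarrow> M $ (g, h) $ (g', h') = 0"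
  by (rule support) (auto dest: rel_eq_iff)

lemma same_row: "(\<Sum>h\<in>UNIV. f h * M $ (g, k) $ (g, h)) = f k * M $ (g, k) $ (g, k)"
proof -
  have "(\<Sum>h\<in>UNIV. f h * M $ (g, k) $ (g, h)) =
      (\<Sum>h\<in>UNIV. if h = k then f k * M $ (g, k) $ (g, k) else 0)"
    by (intro sum.cong) (auto intro!: support_eq)
  then show ?thesis by simp
qed

lemma same_col: "(\<Sum>g\<in>UNIV. f g * M $ (k, h) $ (g, h)) = f k * M $ (k, h) $ (k, h)"
proof -
  have "(\<Sum>g\<in>UNIV. f g * M $ (k, h) $ (g, h)) =
      (\<Sum>g\<in>UNIV. if g = k then f k * M $ (k, h) $ (k, h) else 0)"
    by (intro sum.cong) (auto intro!: support_eq)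
  then show ?thesis by simp
qed

text \<open>All fibre blocks have sum 1, so \<open>psd_block_eq\<close> makes the sum of row
  \<open>u\<close> over a fibre independent of the fibre. Over the fibre of \<open>u\<close> itself
  only the diagonal entry survives.\<close>

lemma row_sum: "(\<Sum>h\<in>UNIV. M $ u $ (g, h)) = M $ u $ u"
proof -
  obtain g0 h0 where u: "u = (g0, h0)" by fastforce
  have "(\<Sum>v\<in>{g} \<times> UNIV. M $ u $ v) = (\<Sum>v\<in>{g0} \<times> UNIV. M $ u $ v)"
    by (rule psd_block_eq[OF psd]) (simp add: sum_fst_fibre block_G)
  then show ?thesis
    using same_row[of "\<lambda>_. 1" g0 h0] by (simp add: sum_fst_fibre u)
qed

lemma col_sum: "(\<Sum>g\<in>UNIV. M $ u $ (g, h)) = M $ u $ u"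
proof -
  obtain g0 h0 where u: "u = (g0, h0)" by fastforce
  have "(\<Sum>v\<in>UNIV \<times> {h}. M $ u $ v) = (\<Sum>v\<in>UNIV \<times> {h0}. M $ u $ v)"
    by (rule psd_block_eq[OF psd]) (simp add: sum_snd_fibre block_H)
  then show ?thesis
    using same_col[of "\<lambda>_. 1" g0 h0] by (simp add: sum_snd_fibre u)
qed

lemma diag_G: "(\<Sum>h\<in>UNIV. M $ (g, h) $ (g, h)) = 1"
  using block_G[of g g] by (simp add: row_sum)

lemma diag_H: "(\<Sum>g\<in>UNIV. M $ (g, h) $ (g, h)) = 1"
  using block_H[of h h] by (simp add: col_sum)

text \<open>The trace is counted by rows and by columns.\<close>

lemma card_eq: "CARD('a) = CARD('b)"
proof -
  have "real CARD('a) = (\<Sum>g\<in>UNIV. \<Sum>h\<in>UNIV. M $ (g, h) $ (g, h))" by (simp add: diag_G)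
  also have "\<dots> = real CARD('b)" by (subst sum.swap) (simp add: diag_H)
  finally show ?thesis by simp
qed

lemma trace_eq: "trace M = real CARD('a)"
  by (simp add: trace_def sum_pairs diag_G)

lemma total_eq: "trace (M ** all_ones) = (real CARD('a))\<^sup>2"
proof -
  have "trace (M ** all_ones) = (\<Sum>g\<in>UNIV. \<Sum>h\<in>UNIV. \<Sum>g'\<in>(UNIV::'a set). M $ (g, h) $ (g, h))"
    by (simp add: trace_mult_all_ones sum_pairs row_sum)
  also have "\<dots> = (real CARD('a))\<^sup>2"
    by (simp add: diag_G power2_eq_square flip: sum_distrib_left)
  finally show ?thesis .
qed

end

section \<open>Doubly nonnegative isomorphism and the theta function\<close>

lemma dnn_isomorphic_iff: "dnn_isomorphic G H \<longleftrightarrow> (\<exists>M. dnn_isomorphism G H M)"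
  unfolding dnn_isomorphic_def dnn_isomorphism_def DNN_def Bex_def by auto

text \<open>Distinct pairs with equal first component differ in the second, so their relationships
  differ: the fibres of \<open>fst\<close> are cliques of the product.\<close>

lemma theta_le_card:
  fixes G :: "'a::finite \<Rightarrow> 'a \<Rightarrow> bool" and H :: "'b::finite \<Rightarrow> 'b \<Rightarrow> bool"
  assumes "M \<in> theta_feasible (iso_product G H)"
  shows "trace (M ** all_ones) \<le> real CARD('a)"
proof (rule theta_partition(1)[where \<pi> = fst])
  show "M $ u $ v = 0" if "fst u = fst v" "u \<noteq> v" for u v
    using assms that rel_eq_iff[of G "fst u" "fst v" H "snd u" "snd v"]
    by (cases u; cases v) (auto simp: theta_feasible_def iso_product_def)
qed (use assms in \<open>auto simp: theta_feasible_def DNN_def\<close>)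

lemma dnn_isomorphic_imp_theta:
  fixes G :: "'a::finite \<Rightarrow> 'a \<Rightarrow> bool" and H :: "'b::finite \<Rightarrow> 'b \<Rightarrow> bool"
  assumes "dnn_isomorphic G H"
  shows "schrijver_theta (iso_product G H) = real CARD('a) \<and> CARD('a) = CARD('b)"
proof -
  obtain M where "dnn_isomorphism G H M" using assms by (auto simp: dnn_isomorphic_iff)
  then interpret dnn_isomorphism G H M .
  \<comment> \<open>Here \<open>M\<close> has trace \<open>CARD('a)\<close> and total
    \<open>(CARD('a))^2\<close>; dividing by \<open>CARD('a)\<close> makes it feasible with the
    extremal value.\<close>
  define N where "N = (1 / real CARD('a)) *\<^sub>R M"
  have "trace N = 1" "trace (N ** all_ones) = real CARD('a)"
    using trace_eq total_eq unfolding trace_mult_all_ones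
    by (simp_all add: N_def trace_def power2_eq_square flip: sum_divide_distrib)
  moreover have "pos_semidef N"
    using psd by (auto simp: N_def pos_semidef_def transpose_def vec_eq_iff
        simp flip: scaleR_matrix_vector_assoc)
  ultimately have N: "N \<in> theta_feasible (iso_product G H)" "trace (N ** all_ones) = real CARD('a)"
    using nonneg support by (auto simp: theta_feasible_def DNN_def N_def iso_product_def)
  have "schrijver_theta (iso_product G H) = real CARD('a)"
    unfolding schrijver_theta_def
    by (rule cSup_eq_maximum) (use N theta_le_card in \<open>force+\<close>)
  then show ?thesis using card_eq by simp
qed

text \<open>Since the two cardinalities agree, the optimum is extremal for both clique covers, the
  fibres of \<open>fst\<close> and those of \<open>snd\<close>. Every block sum is therefore the
  same reciprocal, which rescaling turns into 1.\<close>

lemma theta_imp_dnn_isomorphic: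
  fixes G :: "'a::finite \<Rightarrow> 'a \<Rightarrow> bool" and H :: "'b::finite \<Rightarrow> 'b \<Rightarrow> bool"
  assumes "simple_graph G" "simple_graph H"
    and theta: "schrijver_theta (iso_product G H) = real CARD('a)" and card: "CARD('a) = CARD('b)"
  shows "dnn_isomorphic G H"
proof -
  obtain N where N: "N \<in> theta_feasible (iso_product G H)" "trace (N ** all_ones) = real CARD('a)"
    using schrijver_theta_attained[OF simple_graph_iso_product[OF assms(1,2)]] theta by metis
  then have psd: "pos_semidef N" and nonneg: "\<And>u v. 0 \<le> N $ u $ v" and tr: "trace N = 1"
    and supp: "\<And>g h g' h'. rel G g g' \<noteq> rel H h h' \<Longrightarrow> N $ (g, h) $ (g', h') = 0"
    by (auto simp: theta_feasible_def DNN_def iso_product_def)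
  have supp_eq: "N $ u $ v = 0" if "(fst u = fst v) \<noteq> (snd u = snd v)" for u v
    using that rel_eq_iff[of G "fst u" "fst v" H "snd u" "snd v"]
      supp[of "fst u" "fst v" "snd u" "snd v"] by auto
  have row: "(\<Sum>h\<in>UNIV. \<Sum>h'\<in>UNIV. N $ (g, h) $ (g', h')) = 1 / real CARD('a)" for g g'
    using theta_partition(2)[where M = N and \<pi> = fst and k = g and l = g'] psd tr N(2) supp_eq
    by (simp add: fst_vimage_singleton sum_fst_fibre prod_eq_iff)
  have col: "(\<Sum>g\<in>UNIV. \<Sum>g'\<in>UNIV. N $ (g, h) $ (g', h')) = 1 / real CARD('a)" for h h'
    using theta_partition(2)[where M = N and \<pi> = snd and k = h and l = h'] psd tr N(2) supp_eq
    by (simp add: snd_vimage_singleton sum_snd_fibre prod_eq_iff card)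
  define M where "M = real CARD('a) *\<^sub>R N"
  have "pos_semidef M"
    using psd by (auto simp: M_def pos_semidef_def transpose_def vec_eq_iff
        simp flip: scaleR_matrix_vector_assoc)
  then have "dnn_isomorphism G H M"
    using nonneg supp row col
    by unfold_locales (auto simp: M_def simp flip: sum_distrib_left)
  then show ?thesis by (auto simp: dnn_isomorphic_iff)
qed

section \<open>The Lasserre hierarchy\<close>

lemma sum_option: "(\<Sum>s\<in>UNIV. f s) = f None + (\<Sum>u\<in>UNIV. f (Some u))"
  for f :: "'v::finite option \<Rightarrow> 'c::comm_monoid_add"
  by (simp add: UNIV_option_conv sum.reindex)

lemma lasserre_matrix_entry [simp]:
  "lasserre_matrix y $ None $ None = y {}"
  "lasserre_matrix y $ None $ Some v = y {v}"
  "lasserre_matrix y $ Some u $ None = y {u}"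
  "lasserre_matrix y $ Some u $ Some v = y {u, v}"
  by (simp_all add: lasserre_matrix_def insert_commute)

text \<open>The blocks of the moment matrix on \<open>F\<close> by \<open>F\<close>, on
  \<open>F\<close> by the empty set, and on the empty set by itself all have sum 1. By the equality
  case the rows of the singletons over \<open>F\<close> add up to the row of the empty set.\<close>

lemma lasserre_fibre_sum:
  assumes psd: "pos_semidef (lasserre_matrix y)" and "y {} = 1"
    and one: "(\<Sum>u\<in>F. y {u}) = 1"
    and zero: "\<And>u v. u \<in> F \<Longrightarrow> v \<in> F \<Longrightarrow> u \<noteq> v \<Longrightarrow> y {u, v} = 0"
  shows "(\<Sum>v\<in>F. y {u, v}) = y {u}"
proof -
  have "(\<Sum>v\<in>F. y {u, v}) = y {u}" if "u \<in> F" for u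
  proof -
    have "(\<Sum>v\<in>F. y {u, v}) = (\<Sum>v\<in>F. if v = u then y {u} else 0)"
      using that zero by (intro sum.cong) auto
    then show ?thesis using that by simp
  qed
  then have "(\<Sum>u\<in>F. \<Sum>v\<in>F. y {u, v}) = 1" using one by simp
  then have "(\<Sum>t\<in>Some ` F. lasserre_matrix y $ Some u $ t) = (\<Sum>t\<in>{None}. lasserre_matrix y $ Some u $ t)"
    using assms(2) one by (intro psd_block_eq[OF psd]) (simp add: sum.reindex)
  then show ?thesis by (simp add: sum.reindex)
qed

lemma lasserre_imp_dnn_isomorphic:
  fixes G :: "'a::finite \<Rightarrow> 'a \<Rightarrow> bool" and H :: "'b::finite \<Rightarrow> 'b \<Rightarrow> bool"
  assumes "nonneg_lasserre_solution G H y"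
  shows "dnn_isomorphic G H"
proof -
  have psd: "pos_semidef (lasserre_matrix y)" and "y {} = 1"
    and row: "\<And>g. (\<Sum>h\<in>UNIV. y {(g, h)}) = 1" and col: "\<And>h. (\<Sum>g\<in>UNIV. y {(g, h)}) = 1"
    and supp: "\<And>g h g' h'. rel G g g' \<noteq> rel H h h' \<Longrightarrow> y {(g, h), (g', h')} = 0"
    and nonneg: "\<And>S. card S \<le> 2 \<Longrightarrow> 0 \<le> y S"
    using assms by (auto simp: nonneg_lasserre_solution_def lasserre_solution_def)
  have supp_eq: "y {(g, h), (g', h')} = 0" if "(g = g') \<noteq> (h = h')" for g h g' h'
    using that rel_eq_iff[of G g g' H h h'] supp by blast
  have row': "(\<Sum>v\<in>{g} \<times> UNIV. y {u, v}) = y {u}" for u g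
    using row by (intro lasserre_fibre_sum[OF psd \<open>y {} = 1\<close>]) (auto simp: sum_fst_fibre intro: supp_eq)
  have col': "(\<Sum>v\<in>UNIV \<times> {h}. y {u, v}) = y {u}" for u h
    using col by (intro lasserre_fibre_sum[OF psd \<open>y {} = 1\<close>]) (auto simp: sum_snd_fibre intro: supp_eq)
  define M :: "real^('a \<times> 'b)^('a \<times> 'b)" where "M = (\<chi> u v. y {u, v})"
  have "pos_semidef M"
    unfolding pos_semidef_def
  proof (intro conjI allI)
    show "transpose M = M" by (simp add: M_def transpose_def vec_eq_iff insert_commute)
    fix x :: "real^('a \<times> 'b)"
    \<comment> \<open>Padding with 0 at the empty set exhibits \<open>M\<close> as a principal
      submatrix of the moment matrix.\<close>
    define z :: "real^('a \<times> 'b) option" where "z = (\<chi> s. case s of None \<Rightarrow> 0 | Some u \<Rightarrow> x $ u)"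
    have "0 \<le> z \<bullet> (lasserre_matrix y *v z)" using psd by (simp add: pos_semidef_def)
    then show "0 \<le> x \<bullet> (M *v x)"
      by (simp add: inner_vec_def matrix_vector_mult_def sum_option z_def M_def)
  qed
  moreover have "0 \<le> M $ u $ v" for u v
    unfolding M_def by (simp, rule nonneg) (simp add: card_insert_if)
  ultimately have "dnn_isomorphism G H M"
    using row col supp row' col'
    by unfold_locales (simp_all add: M_def sum_fst_fibre sum_snd_fibre)
  then show ?thesis by (auto simp: dnn_isomorphic_iff)
qed

section \<open>From a doubly nonnegative isomorphism matrix to a Lasserre solution\<close>

context dnn_isomorphism
begin

text \<open>The description is well defined on sets of one or two elements because \<open>M\<close>
  is symmetric; a singleton is read as \<open>{u, u}\<close> and gets a diagonal entry. Larger sets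
  get an unspecified value.\<close>

definition lasserre_vector :: "('a \<times> 'b) set \<Rightarrow> real" where
  "lasserre_vector S = (if S = {} then 1 else THE r. \<exists>u v. S = {u, v} \<and> r = M $ u $ v)"

lemma lasserre_vector_pair: "lasserre_vector {u, v} = M $ u $ v"
proof -
  have "(THE r. \<exists>u' v'. {u, v} = {u', v'} \<and> r = M $ u' $ v') = M $ u $ v"
  proof (rule the_equality)
    show "r = M $ u $ v" if "\<exists>u' v'. {u, v} = {u', v'} \<and> r = M $ u' $ v'" for r
      using that sym[of u v] by (auto simp only: doubleton_eq_iff)
  qed blast
  then show ?thesis by (simp add: lasserre_vector_def)
qed

lemma lasserre_vector_singleton: "lasserre_vector {u} = M $ u $ u"
  using lasserre_vector_pair[of u u] by simp

lemma lasserre_vector_psd: "pos_semidef (lasserre_matrix lasserre_vector)"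
  unfolding pos_semidef_def
proof (intro conjI allI)
  let ?L = "lasserre_matrix lasserre_vector"
  show "transpose ?L = ?L"
    by (simp add: transpose_def vec_eq_iff lasserre_matrix_def Un_commute)
  fix x :: "real^('a \<times> 'b) option"
  \<comment> \<open>The row of the empty set is the sum of the rows of the singletons over a fibre, so the
    bordered form is the form of \<open>M\<close> at a shifted vector.\<close>
  obtain g :: 'a where True by simp
  define t where "t = x $ None"
  define p where "p = (\<chi> u. x $ Some u)"
  define d where "d = (\<chi> u. M $ u $ u)"
  define e where "e = indicator_vec ({g} \<times> (UNIV :: 'b set))"
  have Me: "M *v e = d"
    by (simp add: vec_eq_iff e_def d_def mult_indicator_vec sum_fst_fibre row_sum)
  have ee: "e \<bullet> d = 1"
    by (simp add: e_def d_def indicator_vec_inner sum_fst_fibre diag_G)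
  have pe: "e \<bullet> (M *v p) = p \<bullet> d"
    using sym_inner_commute[of M e p] psd by (simp add: Me pos_semidef_def)
  have "0 \<le> (p + t *\<^sub>R e) \<bullet> (M *v (p + t *\<^sub>R e))"
    using psd by (simp add: pos_semidef_def)
  also have "\<dots> = p \<bullet> (M *v p) + 2 * t * (p \<bullet> d) + t * t"
    by (simp add: matrix_vector_right_distrib matrix_vector_mult_scaleR inner_add_left
        inner_add_right Me ee pe distrib_left)
  also have "\<dots> = x \<bullet> (?L *v x)"
  proof -
    have L_None: "(?L *v x) $ None = t + p \<bullet> d"
      by (simp add: inner_vec_def matrix_vector_mult_def sum_option lasserre_vector_singleton
          p_def d_def t_def) (simp add: lasserre_vector_def mult.commute)
    have L_Some: "(?L *v x) $ Some u = t * d $ u + (M *v p) $ u" for u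
      by (simp add: matrix_vector_mult_def sum_option lasserre_vector_singleton
          lasserre_vector_pair p_def d_def t_def mult.commute)
    have "x \<bullet> (?L *v x) = t * (t + p \<bullet> d) + (\<Sum>u\<in>UNIV. p $ u * (t * d $ u + (M *v p) $ u))"
      by (simp add: inner_vec_def[of x] sum_option L_None L_Some p_def flip: t_def)
    also have "(\<Sum>u\<in>UNIV. p $ u * (t * d $ u + (M *v p) $ u)) = t * (p \<bullet> d) + p \<bullet> (M *v p)"
      by (simp add: inner_vec_def sum.distrib sum_distrib_left distrib_left mult.left_commute)
    finally show ?thesis by (simp add: distrib_left)
  qed
  finally show "0 \<le> x \<bullet> (?L *v x)" .
qed

lemma lasserre_vector_solution: "nonneg_lasserre_solution G H lasserre_vector"
  unfolding nonneg_lasserre_solution_def lasserre_solution_def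
proof (intro conjI allI impI lasserre_vector_psd)
  fix S :: "('a \<times> 'b) set"
  assume "card S \<le> 2"
  then consider "card S = 0" | "card S = 1" | "card S = 2" by linarith
  then show "0 \<le> lasserre_vector S"
  proof cases
    case 1
    then show ?thesis by (simp add: lasserre_vector_def)
  next
    case 2
    then obtain u where "S = {u}" by (rule card_1_singletonE)
    then show ?thesis by (simp add: lasserre_vector_singleton nonneg)
  next
    case 3
    then obtain u v where "S = {u, v}" by (auto simp: card_2_iff)
    then show ?thesis by (simp add: lasserre_vector_pair nonneg)
  qed
qed (simp_all add: lasserre_vector_singleton lasserre_vector_pair diag_G diag_H support,
     simp add: lasserre_vector_def)

end

section \<open>From doubly nonnegative matrices to coherent algebras\<close>

text \<open>The isomorphism is first built as a relation between all matrices, compatible with every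
  operation. Being symmetric in the two sides, it can be transported in either direction before
  domain and range are known.\<close>

locale coherent_relation =
  fixes R :: "complex^'n^'n \<Rightarrow> complex^'m^'m \<Rightarrow> bool"
  assumes add: "R X Y \<Longrightarrow> R X' Y' \<Longrightarrow> R (X + X') (Y + Y')"
    and scale: "R X Y \<Longrightarrow> R (cscale c X) (cscale c Y)"
    and mult: "R X Y \<Longrightarrow> R X' Y' \<Longrightarrow> R (X ** X') (Y ** Y')"
    and schur: "R X Y \<Longrightarrow> R X' Y' \<Longrightarrow> R (schur_product X X') (schur_product Y Y')"
    and adjoint: "R X Y \<Longrightarrow> R (conj_transpose X) (conj_transpose Y)"
    and one: "R (mat 1) (mat 1)"
    and ones: "R all_ones all_ones"
begin

lemma converse: "coherent_relation (\<lambda>Y X. R X Y)"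
  by unfold_locales (auto intro: add scale mult schur adjoint one ones)

lemma zero: "R 0 0"
proof -
  have "cscale 0 (mat 1 :: complex^'k^'k) = 0" by (simp add: vec_eq_iff)
  then show ?thesis using scale[OF one, of 0] by metis
qed

lemma coherent_image:
  assumes "coherent_algebra \<A>"
  shows "coherent_algebra {Y. \<exists>X\<in>\<A>. R X Y}"
proof -
  have A: "0 \<in> \<A>" "\<And>X Y. X \<in> \<A> \<Longrightarrow> Y \<in> \<A> \<Longrightarrow> X + Y \<in> \<A>" "\<And>c X. X \<in> \<A> \<Longrightarrow> cscale c X \<in> \<A>"
    "\<And>X Y. X \<in> \<A> \<Longrightarrow> Y \<in> \<A> \<Longrightarrow> X ** Y \<in> \<A>"
    "\<And>X Y. X \<in> \<A> \<Longrightarrow> Y \<in> \<A> \<Longrightarrow> schur_product X Y \<in> \<A>"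
    "\<And>X. X \<in> \<A> \<Longrightarrow> conj_transpose X \<in> \<A>" "mat 1 \<in> \<A>" "all_ones \<in> \<A>"
    using assms by (auto simp: coherent_algebra_def cmat.subspace_def)
  let ?S = "{Y. \<exists>X\<in>\<A>. R X Y}"
  have S: "0 \<in> ?S" "mat 1 \<in> ?S" "all_ones \<in> ?S"
    using A(1,7,8) zero one ones by auto
  have S1: "Y + Y' \<in> ?S" if "Y \<in> ?S" "Y' \<in> ?S" for Y Y'
    using that A(2) add by auto meson
  have S2: "cscale c Y \<in> ?S" if "Y \<in> ?S" for c Y
    using that A(3) scale by auto meson
  have S3: "Y ** Y' \<in> ?S" if "Y \<in> ?S" "Y' \<in> ?S" for Y Y'
    using that A(4) mult by auto meson
  have S4: "schur_product Y Y' \<in> ?S" if "Y \<in> ?S" "Y' \<in> ?S" for Y Y'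
    using that A(5) schur by auto meson
  have S5: "conj_transpose Y \<in> ?S" if "Y \<in> ?S" for Y
    using that A(6) adjoint by auto
  show ?thesis
    unfolding coherent_algebra_def cmat.subspace_def
    by (intro conjI ballI allI S S1 S2 S3 S4 S5; assumption)
qed

end

lemma coherent_algebra_of_graph: "coherent_algebra (coherent_algebra_of G)"
  unfolding coherent_algebra_of_def coherent_algebra_def
  by (auto intro!: cmat.subspace_Inter)

lemma adjacency_matrix_mem: "adjacency_matrix G \<in> coherent_algebra_of G"
  by (auto simp: coherent_algebra_of_def)

lemma coherent_algebra_of_minimal:
  "coherent_algebra \<A> \<Longrightarrow> adjacency_matrix G \<in> \<A> \<Longrightarrow> coherent_algebra_of G \<subseteq> \<A>"
  by (auto simp: coherent_algebra_of_def)

text \<open>The image of one generated algebra under \<open>R\<close> is a coherent algebra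
  containing the other adjacency matrix, so by minimality it contains the other generated algebra.
  Used in both directions, this makes \<open>R\<close> total and onto; \<open>left\<close> and
  \<open>right\<close> then make it a bijection.\<close>

lemma coherent_relation_imp_equivalent:
  fixes R :: "complex^'a^'a \<Rightarrow> complex^'b^'b \<Rightarrow> bool"
  assumes "coherent_relation R" and adj: "R (adjacency_matrix G) (adjacency_matrix H)"
    and left: "\<And>X X' Y. R X Y \<Longrightarrow> R X' Y \<Longrightarrow> X = X'"
    and right: "\<And>X Y Y'. R X Y \<Longrightarrow> R X Y' \<Longrightarrow> Y = Y'"
  shows "graphs_equivalent G H"
proof -
  interpret coherent_relation R by fact
  interpret conv: coherent_relation "\<lambda>Y X. R X Y" by (rule converse)
  let ?A = "coherent_algebra_of G" and ?B = "coherent_algebra_of H"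
  have "?B \<subseteq> {Y. \<exists>X\<in>?A. R X Y}"
    using adj by (intro coherent_algebra_of_minimal coherent_image coherent_algebra_of_graph)
      (auto intro: adjacency_matrix_mem)
  then have surj: "\<exists>X\<in>?A. R X Y" if "Y \<in> ?B" for Y using that by blast
  have "?A \<subseteq> {X. \<exists>Y\<in>?B. R X Y}"
    using adj by (intro coherent_algebra_of_minimal conv.coherent_image coherent_algebra_of_graph)
      (auto intro: adjacency_matrix_mem)
  then have total: "\<exists>Y\<in>?B. R X Y" if "X \<in> ?A" for X using that by blast
  define \<phi> where "\<phi> X = (THE Y. R X Y)" for X
  have \<phi>: "\<phi> X = Y" if "R X Y" for X Y
    unfolding \<phi>_def using that right by blast
  have R\<phi>: "R X (\<phi> X)" "\<phi> X \<in> ?B" if "X \<in> ?A" for X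
    using total[OF that] \<phi> by auto
  have "bij_betw \<phi> ?A ?B"
    unfolding bij_betw_def
  proof (intro conjI inj_onI)
    show "X = X'" if "X \<in> ?A" "X' \<in> ?A" "\<phi> X = \<phi> X'" for X X'
      using that R\<phi>(1) left by metis
    show "\<phi> ` ?A = ?B"
      using R\<phi>(2) surj \<phi> by (fastforce simp: image_iff)
  qed
  then have "coherent_algebra_iso \<phi> ?A ?B"
    unfolding coherent_algebra_iso_def
    by (auto intro!: \<phi> add scale mult schur adjoint R\<phi>(1))
  moreover have "\<phi> (adjacency_matrix G) = adjacency_matrix H" by (rule \<phi>[OF adj])
  ultimately show ?thesis by (auto simp: graphs_equivalent_def)
qed

context dnn_isomorphism
begin

text \<open>Stated entrywise, so that closure under sums and Schur products is immediate. Closure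
  under matrix products goes through the equivalent intertwining identity of the next
  lemmas.\<close>

definition linked :: "complex^'a^'a \<Rightarrow> complex^'b^'b \<Rightarrow> bool" where
  "linked X Y \<longleftrightarrow> (\<forall>g h g' h'. M $ (g, h) $ (g', h') \<noteq> 0 \<longrightarrow> X $ g $ g' = Y $ h $ h')"

lemma intertwine_real:
  assumes xy: "\<And>g' k. M $ (g, k) $ (g', h') \<noteq> 0 \<Longrightarrow> x g' = y k"
  shows "(\<Sum>g'\<in>UNIV. x g' * M $ u $ (g', h')) = (\<Sum>k\<in>UNIV. y k * M $ u $ (g, k))"
proof -
  \<comment> \<open>The two sides are entries of \<open>M\<close> times the two parts of \<open>c\<close>; the vector \<open>M *v c\<close> vanishes
    on the support of \<open>c\<close>.\<close>
  define c :: "real^('a \<times> 'b)" where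
    "c = (\<chi> v. (if snd v = h' then x (fst v) else 0) - (if fst v = g then y (snd v) else 0))"
  have Mc: "(M *v c) $ u =
      (\<Sum>g'\<in>UNIV. x g' * M $ u $ (g', h')) - (\<Sum>k\<in>UNIV. y k * M $ u $ (g, k))" for u
  proof -
    have "(M *v c) $ u = (\<Sum>v\<in>UNIV. if snd v = h' then x (fst v) * M $ u $ v else 0) -
        (\<Sum>v\<in>UNIV. if fst v = g then y (snd v) * M $ u $ v else 0)"
      unfolding matrix_vector_mult_def c_def
      by (simp add: sum_subtractf[symmetric]) (intro sum.cong, auto simp: algebra_simps)
    also have "(\<Sum>v\<in>UNIV. if snd v = h' then x (fst v) * M $ u $ v else 0) =
        (\<Sum>g'\<in>UNIV. x g' * M $ u $ (g', h'))"
      by (simp add: sum_pairs)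
    also have "(\<Sum>v\<in>UNIV. if fst v = g then y (snd v) * M $ u $ v else 0) =
        (\<Sum>k\<in>UNIV. y k * M $ u $ (g, k))"
      unfolding sum_pairs by (subst sum.swap) simp
    finally show ?thesis .
  qed
  \<comment> \<open>The first sum collapses to \<open>x a\<close> times a diagonal entry by
    \<open>same_col\<close>. In the second, \<open>y k\<close> may be replaced by \<open>x a\<close>
    wherever \<open>M\<close> is nonzero, and \<open>row_sum\<close> gives the same value.\<close>
  have "(M *v c) $ (a, h') = 0" for a
  proof -
    have "(\<Sum>k\<in>UNIV. y k * M $ (a, h') $ (g, k)) = (\<Sum>k\<in>UNIV. x a * M $ (a, h') $ (g, k))"
      using xy sym by (intro sum.cong refl) (metis mult_cancel_right)
    then show ?thesis
      by (simp add: Mc same_col row_sum flip: sum_distrib_left)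
  qed
  moreover have "(M *v c) $ (g, b) = 0" for b
  proof -
    have "(\<Sum>g'\<in>UNIV. x g' * M $ (g, b) $ (g', h')) = (\<Sum>g'\<in>UNIV. y b * M $ (g, b) $ (g', h'))"
      using xy by (intro sum.cong refl) (metis mult_cancel_right)
    then show ?thesis
      by (simp add: Mc same_row col_sum flip: sum_distrib_left)
  qed
  \<comment> \<open>The vector \<open>c\<close> is supported on pairs with second component
    \<open>h'\<close> or first component \<open>g\<close>, the two cases just treated.\<close>
  ultimately have "c $ v * (M *v c) $ v = 0" for v
    by (cases v) (auto simp: c_def)
  then have "c \<bullet> (M *v c) = 0" by (simp only: inner_vec_def inner_real_def sum.neutral_const)
  then have "M *v c = 0" by (rule psd_kernel[OF psd])
  then show ?thesis using Mc[of u] by simp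
qed

lemma linked_intertwine:
  assumes "linked X Y"
  shows "(\<Sum>g'\<in>UNIV. X $ g $ g' * complex_of_real (M $ u $ (g', h'))) =
    (\<Sum>k\<in>UNIV. Y $ k $ h' * complex_of_real (M $ u $ (g, k)))"
  using assms intertwine_real[of g h' "\<lambda>g'. Re (X $ g $ g')" "\<lambda>k. Re (Y $ k $ h')" u]
    intertwine_real[of g h' "\<lambda>g'. Im (X $ g $ g')" "\<lambda>k. Im (Y $ k $ h')" u]
  by (intro complex_eqI) (auto simp: linked_def)

text \<open>Read as a kernel between pairs of vertices of the two graphs, \<open>M\<close> has unit
  row and column sums, and the identity makes the entries of \<open>X\<close> and \<open>Y\<close>
  averages of each other. Then the \<open>M\<close>-weighted sum of \<open>|x - y|^2\<close>
  vanishes, and by nonnegativity so does each term.\<close>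

lemma intertwine_linked:
  assumes tw: "\<And>u g h'. (\<Sum>g'\<in>UNIV. X $ g $ g' * complex_of_real (M $ u $ (g', h'))) =
    (\<Sum>k\<in>UNIV. Y $ k $ h' * complex_of_real (M $ u $ (g, k)))"
  shows "linked X Y"
proof -
  \<comment> \<open>Regroups the indices: \<open>p\<close> is a pair of vertices of \<open>G\<close>
    and \<open>q\<close> a pair of vertices of \<open>H\<close>.\<close>
  define m where "m p q = M $ (fst p, fst q) $ (snd p, snd q)" for p q
  define x where "x p = X $ fst p $ snd p" for p
  define y where "y q = Y $ fst q $ snd q" for q
  have same_row': "(\<Sum>k\<in>UNIV. f k * complex_of_real (M $ (g, h) $ (g, k))) =
      f h * complex_of_real (M $ (g, h) $ (g, h))" for f g h
    using same_row[of "\<lambda>k. Re (f k)" g h] same_row[of "\<lambda>k. Im (f k)" g h]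
    by (intro complex_eqI) auto
  have same_col': "(\<Sum>k\<in>UNIV. f k * complex_of_real (M $ (g, h) $ (k, h))) =
      f g * complex_of_real (M $ (g, h) $ (g, h))" for f g h
    using same_col[of "\<lambda>k. Re (f k)" g h] same_col[of "\<lambda>k. Im (f k)" g h]
    by (intro complex_eqI) auto
  have m1: "(\<Sum>q\<in>UNIV. complex_of_real (m p q)) = 1" "(\<Sum>p\<in>UNIV. complex_of_real (m p q)) = 1" for p q
    by (simp_all add: m_def sum_pairs block_G block_H flip: of_real_sum)
  \<comment> \<open>Taking \<open>u = (g, h)\<close> in \<open>tw\<close> leaves a single term on
    the right, by \<open>same_row'\<close>; summing over \<open>g\<close> then uses
    \<open>diag_H\<close>. The companion \<open>ym\<close> takes \<open>u = (g', h')\<close> and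
    collapses the left side.\<close>
  have xm: "(\<Sum>p\<in>UNIV. x p * complex_of_real (m p q)) = y q" for q
  proof -
    obtain h h' where q: "q = (h, h')" by fastforce
    have "(\<Sum>p\<in>UNIV. x p * complex_of_real (m p q)) =
        (\<Sum>g\<in>UNIV. Y $ h $ h' * complex_of_real (M $ (g, h) $ (g, h)))"
      by (simp add: sum_pairs x_def m_def q tw same_row')
    also have "\<dots> = y q"
      by (simp add: y_def q diag_H flip: of_real_sum sum_distrib_left)
    finally show ?thesis .
  qed
  have ym: "(\<Sum>q\<in>UNIV. y q * complex_of_real (m p q)) = x p" for p
  proof -
    obtain g g' where p: "p = (g, g')" by fastforce
    have "(\<Sum>q\<in>UNIV. y q * complex_of_real (m p q)) =
        (\<Sum>h'\<in>UNIV. \<Sum>h\<in>UNIV. Y $ h $ h' * complex_of_real (M $ (g', h') $ (g, h)))"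
      unfolding sum_pairs by (subst sum.swap) (simp add: y_def m_def p sym)
    also have "\<dots> = (\<Sum>h'\<in>UNIV. X $ g $ g' * complex_of_real (M $ (g', h') $ (g', h')))"
      by (simp add: tw[symmetric] same_col')
    also have "\<dots> = x p"
      by (simp add: x_def p diag_G flip: of_real_sum sum_distrib_left)
    finally show ?thesis .
  qed
  have "(\<Sum>p\<in>UNIV. \<Sum>q\<in>UNIV. (x p - y q) * cnj (x p) * complex_of_real (m p q)) =
      (\<Sum>p\<in>UNIV. cnj (x p) * (x p * (\<Sum>q\<in>UNIV. complex_of_real (m p q)) - (\<Sum>q\<in>UNIV. y q * complex_of_real (m p q))))"
    by (simp only: sum_distrib_left sum_subtractf[symmetric]) (simp add: algebra_simps)
  then have X0: "(\<Sum>p\<in>UNIV. \<Sum>q\<in>UNIV. (x p - y q) * cnj (x p) * complex_of_real (m p q)) = 0"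
    by (simp add: m1 ym)
  have "(\<Sum>p\<in>UNIV. \<Sum>q\<in>UNIV. (x p - y q) * cnj (y q) * complex_of_real (m p q)) =
      (\<Sum>q\<in>UNIV. cnj (y q) * ((\<Sum>p\<in>UNIV. x p * complex_of_real (m p q)) - y q * (\<Sum>p\<in>UNIV. complex_of_real (m p q))))"
    by (subst sum.swap) (simp only: sum_distrib_left sum_subtractf[symmetric], simp add: algebra_simps)
  then have Y0: "(\<Sum>p\<in>UNIV. \<Sum>q\<in>UNIV. (x p - y q) * cnj (y q) * complex_of_real (m p q)) = 0"
    by (simp add: m1 xm)
  have "complex_of_real (\<Sum>p\<in>UNIV. \<Sum>q\<in>UNIV. (cmod (x p - y q))\<^sup>2 * m p q) =
      (\<Sum>p\<in>UNIV. \<Sum>q\<in>UNIV. (x p - y q) * cnj (x p) * complex_of_real (m p q)) -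
      (\<Sum>p\<in>UNIV. \<Sum>q\<in>UNIV. (x p - y q) * cnj (y q) * complex_of_real (m p q))"
    by (simp only: of_real_sum of_real_mult complex_norm_square sum_subtractf[symmetric])
       (simp add: algebra_simps)
  then have sum0: "(\<Sum>p\<in>UNIV. \<Sum>q\<in>UNIV. (cmod (x p - y q))\<^sup>2 * m p q) = 0"
    unfolding X0 Y0 by (simp only: diff_self of_real_eq_0_iff)
  have pos: "0 \<le> (cmod (x p - y q))\<^sup>2 * m p q" for p q by (simp add: m_def nonneg)
  from sum0 have "\<forall>p\<in>UNIV. (\<Sum>q\<in>UNIV. (cmod (x p - y q))\<^sup>2 * m p q) = 0"
    by (subst (asm) sum_nonneg_eq_0_iff) (simp_all only: finite sum_nonneg pos)
  then have "(\<Sum>q\<in>UNIV. (cmod (x p - y q))\<^sup>2 * m p q) = 0" for p by blast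
  then have "\<forall>q\<in>UNIV. (cmod (x p - y q))\<^sup>2 * m p q = 0" for p
    by (subst (asm) sum_nonneg_eq_0_iff) (simp_all only: finite pos)
  then have "m p q = 0 \<or> x p = y q" for p q by fastforce
  then show ?thesis
    unfolding linked_def m_def x_def y_def by (metis fst_conv snd_conv)
qed

text \<open>Intertwining identities compose: \<open>X'\<close> is exchanged for \<open>Y'\<close>
  first, then \<open>X\<close> for \<open>Y\<close>, with the other factor carried along as a
  constant.\<close>

lemma linked_mult:
  assumes XY: "linked X Y" and XY': "linked X' Y'"
  shows "linked (X ** X') (Y ** Y')"
proof (rule intertwine_linked)
  fix u g h'
  let ?m = "\<lambda>v. complex_of_real (M $ u $ v)"
  have "(\<Sum>g'\<in>UNIV. (X ** X') $ g $ g' * ?m (g', h')) =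
      (\<Sum>k\<in>UNIV. X $ g $ k * (\<Sum>g'\<in>UNIV. X' $ k $ g' * ?m (g', h')))"
    unfolding matrix_matrix_mult_def vec_lambda_beta sum_distrib_right sum_distrib_left
    by (subst sum.swap) (simp only: mult.assoc)
  also have "\<dots> = (\<Sum>k\<in>UNIV. X $ g $ k * (\<Sum>l\<in>UNIV. Y' $ l $ h' * ?m (k, l)))"
    by (simp only: linked_intertwine[OF XY'])
  also have "\<dots> = (\<Sum>l\<in>UNIV. Y' $ l $ h' * (\<Sum>k\<in>UNIV. X $ g $ k * ?m (k, l)))"
    unfolding sum_distrib_left by (subst sum.swap) (simp only: mult.left_commute)
  also have "\<dots> = (\<Sum>l\<in>UNIV. Y' $ l $ h' * (\<Sum>k\<in>UNIV. Y $ k $ l * ?m (g, k)))"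
    by (simp only: linked_intertwine[OF XY])
  also have "\<dots> = (\<Sum>k\<in>UNIV. (Y ** Y') $ k $ h' * ?m (g, k))"
    unfolding matrix_matrix_mult_def vec_lambda_beta sum_distrib_right sum_distrib_left
    by (subst sum.swap) (simp only: mult_ac)
  finally show "(\<Sum>g'\<in>UNIV. (X ** X') $ g $ g' * ?m (g', h')) =
    (\<Sum>k\<in>UNIV. (Y ** Y') $ k $ h' * ?m (g, k))" .
qed

lemma linked_coherent: "coherent_relation linked"
proof
  show "linked (mat 1) (mat 1)"
    using support_eq by (auto simp: linked_def mat_def)
  show "linked (conj_transpose X) (conj_transpose Y)" if "linked X Y" for X Y
    using that sym by (simp add: linked_def conj_transpose_def transpose_def)
  show "linked (X ** X') (Y ** Y')" if "linked X Y" "linked X' Y'" for X Y X' Y'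
    using that by (rule linked_mult)
qed (auto simp: linked_def schur_product_def all_ones_def)

lemma linked_adjacency:
  assumes "simple_graph G" "simple_graph H"
  shows "linked (adjacency_matrix G) (adjacency_matrix H)"
  unfolding linked_def
proof (intro allI impI)
  fix g h g' h' assume "M $ (g, h) $ (g', h') \<noteq> 0"
  then have "rel G g g' = rel H h h'" using support by blast
  then have "G g g' \<longleftrightarrow> H h h'"
    using assms by (auto simp: rel_def simple_graph_def irreflp_def split: if_splits)
  then show "adjacency_matrix G $ g $ g' = adjacency_matrix H $ h $ h'"
    by (simp add: adjacency_matrix_def)
qed

text \<open>A block with sum 1 has a nonzero entry, so each entry of \<open>Y\<close> is dictated by
  some entry of \<open>X\<close>.\<close>

lemma linked_right_unique:
  assumes "linked X Y" "linked X Y'"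
  shows "Y = Y'"
proof -
  have "Y $ h $ h' = Y' $ h $ h'" for h h'
  proof -
    obtain g g' where "M $ (g, h) $ (g', h') \<noteq> 0"
      using block_H[of h h'] by (metis (no_types, lifting) sum.neutral zero_neq_one)
    then show ?thesis using assms unfolding linked_def by metis
  qed
  then show ?thesis by (simp add: vec_eq_iff)
qed

lemma linked_left_unique:
  assumes "linked X Y" "linked X' Y"
  shows "X = X'"
proof -
  have "X $ g $ g' = X' $ g $ g'" for g g'
  proof -
    obtain h h' where "M $ (g, h) $ (g', h') \<noteq> 0"
      using block_G[of g g'] by (metis (no_types, lifting) sum.neutral zero_neq_one)
    then show ?thesis using assms unfolding linked_def by metis
  qed
  then show ?thesis by (simp add: vec_eq_iff)
qed

end

lemma dnn_isomorphic_imp_equivalent: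
  assumes "simple_graph G" "simple_graph H" "dnn_isomorphic G H"
  shows "graphs_equivalent G H"
proof -
  obtain M where "dnn_isomorphism G H M" using assms(3) by (auto simp: dnn_isomorphic_iff)
  then interpret dnn_isomorphism G H M .
  show ?thesis
    using linked_coherent linked_adjacency[OF assms(1,2)] linked_left_unique linked_right_unique
    by (rule coherent_relation_imp_equivalent)
qed

section \<open>From coherent algebras to doubly nonnegative matrices\<close>

text \<open>In effect two coherent configurations coloured from one common set, with the same
  intersection numbers (\<open>count_match\<close>) and the same class sizes. The assumptions only
  compare pairs across the two graphs; comparisons inside one graph pass through the other.\<close>

locale colour_matching =
  fixes G :: "'a::finite \<Rightarrow> 'a \<Rightarrow> bool" and H :: "'b::finite \<Rightarrow> 'b \<Rightarrow> bool"
    and \<kappa> :: "'a \<Rightarrow> 'a \<Rightarrow> 'c" and \<nu> :: "'b \<Rightarrow> 'b \<Rightarrow> 'c"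
  assumes match_G: "\<exists>h h'. \<kappa> g g' = \<nu> h h'"
    and match_H: "\<exists>g g'. \<kappa> g g' = \<nu> h h'"
    and rel_match: "\<kappa> g g' = \<nu> h h' \<Longrightarrow> rel G g g' = rel H h h'"
    and converse_match: "\<kappa> g g' = \<nu> h h' \<Longrightarrow> \<kappa> g' g = \<nu> h' h"
    and count_match: "\<kappa> g g' = \<nu> h h' \<Longrightarrow>
      card {k. \<kappa> g k = i \<and> \<kappa> k g' = j} = card {l. \<nu> h l = i \<and> \<nu> l h' = j}"
    and size_match: "card {p. \<kappa> (fst p) (snd p) = i} = card {q. \<nu> (fst q) (snd q) = i}"
begin

lemma path_sum_match:
  fixes f :: "'c \<Rightarrow> 'c \<Rightarrow> real"
  assumes "\<kappa> g g' = \<nu> h h'"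
  shows "(\<Sum>k\<in>UNIV. f (\<kappa> g k) (\<kappa> k g')) = (\<Sum>l\<in>UNIV. f (\<nu> h l) (\<nu> l h'))"
proof -
  \<comment> \<open>The colour type may be infinite, so the sum is grouped over the finitely many
    colour pairs that occur.\<close>
  define R where "R = range (\<lambda>k. (\<kappa> g k, \<kappa> k g')) \<union> range (\<lambda>l. (\<nu> h l, \<nu> l h'))"
  have "finite R" by (simp add: R_def)
  have "(\<Sum>k\<in>UNIV. case_prod f (\<kappa> g k, \<kappa> k g')) =
      (\<Sum>c\<in>R. of_nat (card {k \<in> UNIV. (\<kappa> g k, \<kappa> k g') = c}) * case_prod f c)"
    by (rule sum_fun_comp) (use \<open>finite R\<close> in \<open>auto simp: R_def\<close>)
  also have "\<dots> = (\<Sum>c\<in>R. of_nat (card {l \<in> UNIV. (\<nu> h l, \<nu> l h') = c}) * case_prod f c)"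
  proof (intro sum.cong refl)
    fix c :: "'c \<times> 'c"
    show "of_nat (card {k \<in> UNIV. (\<kappa> g k, \<kappa> k g') = c}) * case_prod f c =
        of_nat (card {l \<in> UNIV. (\<nu> h l, \<nu> l h') = c}) * case_prod f c"
      using count_match[OF assms, of "fst c" "snd c"] by (simp add: prod_eq_iff)
  qed
  also have "\<dots> = (\<Sum>l\<in>UNIV. case_prod f (\<nu> h l, \<nu> l h'))"
    by (rule sum_fun_comp[symmetric]) (use \<open>finite R\<close> in \<open>auto simp: R_def\<close>)
  finally show ?thesis by simp
qed

definition class_size :: "'c \<Rightarrow> real" where
  "class_size c = real (card {p. \<kappa> (fst p) (snd p) = c})"

definition witness :: "real^('a \<times> 'b)^('a \<times> 'b)" where
  "witness = (\<chi> u v. if \<kappa> (fst u) (fst v) = \<nu> (snd u) (snd v)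
     then 1 / class_size (\<kappa> (fst u) (fst v)) else 0)"

lemma size_pos: "class_size (\<kappa> g g') > 0"
  unfolding class_size_def of_nat_0_less_iff card_gt_0_iff
  by (intro conjI finite) (auto intro: exI[of _ "(g, g')"])

lemma size_converse: "class_size (\<kappa> g' g) = class_size (\<kappa> g g')"
proof -
  have conv: "\<kappa> b a = \<kappa> d c" if "\<kappa> a b = \<kappa> c d" for a b c d
  proof -
    obtain h h' where cd: "\<kappa> c d = \<nu> h h'" using match_G by blast
    have "\<kappa> a b = \<nu> h h'" unfolding that cd ..
    then have "\<kappa> b a = \<nu> h' h" by (rule converse_match)
    also have "\<dots> = \<kappa> d c" unfolding converse_match[OF cd] ..
    finally show ?thesis .
  qed
  have swap: "prod.swap \<in> {p. \<kappa> (fst p) (snd p) = \<kappa> a b} \<rightarrow> {p. \<kappa> (fst p) (snd p) = \<kappa> b a}" for a b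
  proof (rule funcsetI)
    fix p assume "p \<in> {p. \<kappa> (fst p) (snd p) = \<kappa> a b}"
    then have "\<kappa> (fst p) (snd p) = \<kappa> a b" by simp
    then have "\<kappa> (snd p) (fst p) = \<kappa> b a" by (rule conv)
    then show "prod.swap p \<in> {p. \<kappa> (fst p) (snd p) = \<kappa> b a}" by simp
  qed
  have "bij_betw prod.swap {p. \<kappa> (fst p) (snd p) = \<kappa> g g'} {p. \<kappa> (fst p) (snd p) = \<kappa> g' g}"
    using swap[of g g'] swap[of g' g] by (rule bij_betwI) simp_all
  from bij_betw_same_card[OF this] show ?thesis by (simp only: class_size_def)
qed

lemma witness_sym: "transpose witness = witness"
proof -
  have "witness $ v $ u = witness $ u $ v" for u v
  proof (cases "\<kappa> (fst u) (fst v) = \<nu> (snd u) (snd v)")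
    case True
    then show ?thesis
      using converse_match[OF True] size_converse[of "fst v" "fst u"] by (simp add: witness_def)
  next
    case False
    then have "\<kappa> (fst v) (fst u) \<noteq> \<nu> (snd v) (snd u)" using converse_match by blast
    with False show ?thesis by (simp add: witness_def)
  qed
  then show ?thesis by (simp add: vec_eq_iff transpose_def)
qed

text \<open>By \<open>size_match\<close>, exactly \<open>class_size\<close> many pairs of
  \<open>H\<close> carry the colour of \<open>(g, g')\<close>, each contributing the
  reciprocal.\<close>

lemma witness_block_G: "(\<Sum>h\<in>UNIV. \<Sum>h'\<in>UNIV. witness $ (g, h) $ (g', h')) = 1"
proof -
  have "(\<Sum>h\<in>UNIV. \<Sum>h'\<in>UNIV. witness $ (g, h) $ (g', h')) =
      (\<Sum>q\<in>UNIV. if \<nu> (fst q) (snd q) = \<kappa> g g' then 1 / class_size (\<kappa> g g') else 0)"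
    unfolding sum_pairs witness_def by (intro sum.cong refl) auto
  also have "\<dots> = real (card {q. \<nu> (fst q) (snd q) = \<kappa> g g'}) * (1 / class_size (\<kappa> g g'))"
    by (simp only: sum.If_cases finite) simp
  also have "\<dots> = 1"
    using size_pos[of g g'] by (simp add: class_size_def del: of_nat_0_less_iff flip: size_match) blast
  finally show ?thesis .
qed

lemma witness_block_H: "(\<Sum>g\<in>UNIV. \<Sum>g'\<in>UNIV. witness $ (g, h) $ (g', h')) = 1"
proof -
  obtain a a' where a: "\<kappa> a a' = \<nu> h h'" using match_H by blast
  have "(\<Sum>g\<in>UNIV. \<Sum>g'\<in>UNIV. witness $ (g, h) $ (g', h')) =
      (\<Sum>p\<in>UNIV. if \<kappa> (fst p) (snd p) = \<nu> h h' then 1 / class_size (\<nu> h h') else 0)"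
    unfolding sum_pairs witness_def by (intro sum.cong refl) auto
  also have "\<dots> = real (card {p. \<kappa> (fst p) (snd p) = \<nu> h h'}) * (1 / class_size (\<nu> h h'))"
    by (simp only: sum.If_cases finite) simp
  also have "\<dots> = 1"
    using size_pos[of a a'] by (simp add: class_size_def a del: of_nat_0_less_iff) (rule match_H)
  finally show ?thesis .
qed

text \<open>The real tensor product of the two colour algebras: the two colours enter independently,
  which leaves room for both the identity and \<open>witness\<close>.\<close>

definition colour_algebra :: "(real^('a \<times> 'b)^('a \<times> 'b)) set" where
  "colour_algebra = {W. \<exists>w. \<forall>g h g' h'. W $ (g, h) $ (g', h') = w (\<kappa> g g') (\<nu> h h')}"

lemma colour_algebraE:
  assumes "W \<in> colour_algebra"
  obtains w where "\<And>g h g' h'. W $ (g, h) $ (g', h') = w (\<kappa> g g') (\<nu> h h')"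
  using assms that unfolding colour_algebra_def by blast

lemma colour_algebraI:
  assumes "\<And>g h g' h'. W $ (g, h) $ (g', h') = w (\<kappa> g g') (\<nu> h h')"
  shows "W \<in> colour_algebra"
  using assms unfolding colour_algebra_def by blast

lemma colour_algebra_subspace: "subspace colour_algebra"
proof (rule subspaceI)
  show "0 \<in> colour_algebra" by (rule colour_algebraI[where w = "\<lambda>_ _. 0"]) simp
next
  fix V W assume "V \<in> colour_algebra" "W \<in> colour_algebra"
  then obtain v w where vw: "\<And>g h g' h'. V $ (g, h) $ (g', h') = v (\<kappa> g g') (\<nu> h h')"
    "\<And>g h g' h'. W $ (g, h) $ (g', h') = w (\<kappa> g g') (\<nu> h h')"
    by (elim colour_algebraE) blast
  show "V + W \<in> colour_algebra"
    by (rule colour_algebraI[where w = "\<lambda>c d. v c d + w c d"]) (simp add: vw)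
next
  fix c W assume "W \<in> colour_algebra"
  then obtain w where w: "\<And>g h g' h'. W $ (g, h) $ (g', h') = w (\<kappa> g g') (\<nu> h h')"
    by (elim colour_algebraE) blast
  show "c *\<^sub>R W \<in> colour_algebra"
    by (rule colour_algebraI[where w = "\<lambda>i j. c * w i j"]) (simp add: w)
qed

lemma colour_algebra_mult:
  assumes "V \<in> colour_algebra" "W \<in> colour_algebra"
  shows "V ** W \<in> colour_algebra"
proof -
  obtain v w where vw: "\<And>g h g' h'. V $ (g, h) $ (g', h') = v (\<kappa> g g') (\<nu> h h')"
    "\<And>g h g' h'. W $ (g, h) $ (g', h') = w (\<kappa> g g') (\<nu> h h')"
    using assms by (elim colour_algebraE) blast
  \<comment> \<open>Representatives express the product as a function of colours alone. Each lies in
    the opposite graph, \<open>q c\<close> in \<open>H\<close> and \<open>p d\<close> in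
    \<open>G\<close>, because \<open>path_sum_match\<close> compares path sums across the
    graphs.\<close>
  define q where "q c = (SOME q. \<nu> (fst q) (snd q) = c)" for c
  define p where "p c = (SOME p. \<kappa> (fst p) (snd p) = c)" for c
  have q: "\<kappa> g g' = \<nu> (fst (q (\<kappa> g g'))) (snd (q (\<kappa> g g')))" for g g'
  proof -
    have "\<exists>q. \<nu> (fst q) (snd q) = \<kappa> g g'" using match_G[of g g'] by force
    then have "\<nu> (fst (q (\<kappa> g g'))) (snd (q (\<kappa> g g'))) = \<kappa> g g'" unfolding q_def by (rule someI_ex)
    then show ?thesis by (rule HOL.sym)
  qed
  have p: "\<kappa> (fst (p (\<nu> h h'))) (snd (p (\<nu> h h'))) = \<nu> h h'" for h h'
  proof -
    have "\<exists>p. \<kappa> (fst p) (snd p) = \<nu> h h'" using match_H[of h h'] by force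
    then show ?thesis unfolding p_def by (rule someI_ex)
  qed
  define z where "z c d = (\<Sum>l\<in>UNIV. \<Sum>k\<in>UNIV.
      v (\<nu> (fst (q c)) l) (\<kappa> (fst (p d)) k) * w (\<nu> l (snd (q c))) (\<kappa> k (snd (p d))))" for c d
  show ?thesis
  proof (rule colour_algebraI[where w = z])
    fix g h g' h'
    have "(V ** W) $ (g, h) $ (g', h') =
        (\<Sum>k\<in>UNIV. \<Sum>l\<in>UNIV. v (\<kappa> g k) (\<nu> h l) * w (\<kappa> k g') (\<nu> l h'))"
      by (simp add: matrix_matrix_mult_def sum_pairs vw)
    also have "\<dots> = (\<Sum>k\<in>UNIV. \<Sum>l\<in>UNIV.
        v (\<kappa> g k) (\<kappa> (fst (p (\<nu> h h'))) l) * w (\<kappa> k g') (\<kappa> l (snd (p (\<nu> h h')))))"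
      by (intro sum.cong refl path_sum_match[OF p, symmetric])
    also have "\<dots> = (\<Sum>l\<in>UNIV. \<Sum>k\<in>UNIV.
        v (\<kappa> g k) (\<kappa> (fst (p (\<nu> h h'))) l) * w (\<kappa> k g') (\<kappa> l (snd (p (\<nu> h h')))))"
      by (rule sum.swap)
    also have "\<dots> = (\<Sum>l\<in>UNIV. \<Sum>k\<in>UNIV.
        v (\<nu> (fst (q (\<kappa> g g'))) k) (\<kappa> (fst (p (\<nu> h h'))) l) *
        w (\<nu> k (snd (q (\<kappa> g g')))) (\<kappa> l (snd (p (\<nu> h h')))))"
      by (intro sum.cong refl path_sum_match[OF q])
    also have "\<dots> = z (\<kappa> g g') (\<nu> h h')" unfolding z_def by (rule sum.swap)
    finally show "(V ** W) $ (g, h) $ (g', h') = z (\<kappa> g g') (\<nu> h h')" .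
  qed
qed

text \<open>By \<open>rel_match\<close> the colours of loops never occur on pairs of distinct
  vertices.\<close>

lemma colour_algebra_one: "mat 1 \<in> colour_algebra"
proof (rule colour_algebraI)
  fix g h g' h'
  have eq: "g = g' \<longleftrightarrow> h = h'" if "\<kappa> g g' = \<nu> h h'" for g g' h h'
    using rel_eq_iff[OF rel_match[OF that]] .
  have "(\<exists>a. \<kappa> g g' = \<kappa> a a) \<longleftrightarrow> g = g'" using eq match_G by metis
  moreover have "(\<exists>b. \<nu> h h' = \<nu> b b) \<longleftrightarrow> h = h'" using eq match_H by metis
  ultimately show "mat 1 $ (g, h) $ (g', h') =
      (\<lambda>c d. if (\<exists>a. c = \<kappa> a a) \<and> (\<exists>b. d = \<nu> b b) then 1 else 0) (\<kappa> g g') (\<nu> h h')"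
    by (simp add: mat_def)
qed

lemma witness_mem: "witness \<in> colour_algebra"
  by (rule colour_algebraI[where w = "\<lambda>c d. if c = d then 1 / class_size c else 0"]) (simp add: witness_def)

text \<open>On matching pairs the path sum in \<open>H\<close> may be replaced by one in
  \<open>G\<close>, so the entries of \<open>W ** W\<close> become \<open>F g g'\<close>; the unit
  block sums then remove \<open>witness\<close>. By symmetry of \<open>W\<close> what remains is a
  sum of squares indexed by pairs of vertices of \<open>G\<close>.\<close>

lemma witness_dual:
  assumes W: "W \<in> colour_algebra" "transpose W = W"
  shows "0 \<le> trace (witness ** (W ** W))"
proof -
  obtain w where w: "\<And>g h g' h'. W $ (g, h) $ (g', h') = w (\<kappa> g g') (\<nu> h h')"
    using W(1) by (elim colour_algebraE) blast
  have w_sym: "w (\<kappa> k g) (\<kappa> k' g) = w (\<kappa> g k) (\<kappa> g k')" for g k k'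
  proof -
    \<comment> \<open>A pair of \<open>H\<close> with this colour turns values of \<open>w\<close>
      at two colours of \<open>G\<close> into an entry of \<open>W\<close>, to which the symmetry
      applies.\<close>
    obtain h h' where h: "\<kappa> k' g = \<nu> h h'" using match_G by blast
    have "W $ (k, h) $ (g, h') = W $ (g, h') $ (k, h)"
      using W(2) by (simp add: transpose_def vec_eq_iff)
    then show ?thesis by (simp add: w h converse_match[OF h])
  qed
  define F where "F g g' = (\<Sum>k\<in>UNIV. \<Sum>k'\<in>UNIV. w (\<kappa> g' k) (\<kappa> g' k') * w (\<kappa> k g) (\<kappa> k' g))" for g g'
  have "witness $ (g, h) $ (g', h') * (W ** W) $ (g', h') $ (g, h) =
      witness $ (g, h) $ (g', h') * F g g'" for g h g' h'
  proof (cases "\<kappa> g g' = \<nu> h h'")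
    case True
    have "(W ** W) $ (g', h') $ (g, h) =
        (\<Sum>k\<in>UNIV. \<Sum>l\<in>UNIV. w (\<kappa> g' k) (\<nu> h' l) * w (\<kappa> k g) (\<nu> l h))"
      by (simp add: matrix_matrix_mult_def sum_pairs w)
    also have "\<dots> = F g g'"
      unfolding F_def by (intro sum.cong refl path_sum_match[OF converse_match[OF True], symmetric])
    finally show ?thesis by simp
  qed (simp add: witness_def)
  then have "trace (witness ** (W ** W)) =
      (\<Sum>g\<in>UNIV. \<Sum>h\<in>UNIV. \<Sum>g'\<in>UNIV. \<Sum>h'\<in>UNIV. witness $ (g, h) $ (g', h') * F g g')"
    unfolding trace_def matrix_matrix_mult_def[of witness] by (simp only: sum_pairs vec_lambda_beta)
  also have "\<dots> = (\<Sum>g\<in>UNIV. \<Sum>g'\<in>UNIV. \<Sum>h\<in>UNIV. \<Sum>h'\<in>UNIV. witness $ (g, h) $ (g', h') * F g g')"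
    by (intro sum.cong refl sum.swap)
  also have "\<dots> = (\<Sum>g\<in>UNIV. \<Sum>g'\<in>UNIV. F g g')"
    by (simp add: witness_block_G flip: sum_distrib_right)
  also have "\<dots> = (\<Sum>g\<in>UNIV. \<Sum>g'\<in>UNIV. \<Sum>p\<in>UNIV.
      w (\<kappa> g' (fst p)) (\<kappa> g' (snd p)) * w (\<kappa> g (fst p)) (\<kappa> g (snd p)))"
    by (simp add: F_def sum_pairs w_sym)
  also have "\<dots> = (\<Sum>g\<in>UNIV. \<Sum>p\<in>UNIV. \<Sum>g'\<in>UNIV.
      w (\<kappa> g' (fst p)) (\<kappa> g' (snd p)) * w (\<kappa> g (fst p)) (\<kappa> g (snd p)))"
    by (intro sum.cong refl sum.swap)
  also have "\<dots> = (\<Sum>p\<in>UNIV. \<Sum>g\<in>UNIV. \<Sum>g'\<in>UNIV.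
      w (\<kappa> g' (fst p)) (\<kappa> g' (snd p)) * w (\<kappa> g (fst p)) (\<kappa> g (snd p)))"
    by (rule sum.swap)
  also have "\<dots> = (\<Sum>p\<in>UNIV. (\<Sum>g\<in>UNIV. w (\<kappa> g (fst p)) (\<kappa> g (snd p)))\<^sup>2)"
    by (simp only: power2_eq_square sum_product mult.commute)
  also have "\<dots> \<ge> 0" by (intro sum_nonneg) simp
  finally show ?thesis .
qed

lemma witness_psd: "pos_semidef witness"
  using colour_algebra_subspace colour_algebra_mult colour_algebra_one witness_mem witness_sym witness_dual
  by (rule self_dual_psd)

lemma dnn_isomorphic: "dnn_isomorphic G H"
proof -
  have "dnn_isomorphism G H witness"
  proof
    show "0 \<le> witness $ u $ v" for u v by (simp add: witness_def class_size_def)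
    show "witness $ (g, h) $ (g', h') = 0" if "rel G g g' \<noteq> rel H h h'" for g g' h h'
      using that rel_match by (auto simp: witness_def)
  qed (rule witness_psd witness_block_G witness_block_H)+
  then show ?thesis by (auto simp: dnn_isomorphic_iff)
qed

end

section \<open>Colours of vertex pairs from an isomorphism of coherent algebras\<close>

locale coherent_isomorphism =
  fixes \<phi> :: "complex^'a^'a \<Rightarrow> complex^'b^'b" and \<A> \<B>
  assumes coherent_A: "coherent_algebra \<A>" and coherent_B: "coherent_algebra \<B>"
    and iso: "coherent_algebra_iso \<phi> \<A> \<B>"
begin

lemma closed:
  "X \<in> \<A> \<Longrightarrow> Y \<in> \<A> \<Longrightarrow> X + Y \<in> \<A>" "X \<in> \<A> \<Longrightarrow> cscale c X \<in> \<A>"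
  "X \<in> \<A> \<Longrightarrow> Y \<in> \<A> \<Longrightarrow> X ** Y \<in> \<A>" "X \<in> \<A> \<Longrightarrow> Y \<in> \<A> \<Longrightarrow> schur_product X Y \<in> \<A>"
  "X \<in> \<A> \<Longrightarrow> conj_transpose X \<in> \<A>" "mat 1 \<in> \<A>" "all_ones \<in> \<A>"
  using coherent_A by (auto simp: coherent_algebra_def cmat.subspace_def)

lemma hom:
  "X \<in> \<A> \<Longrightarrow> Y \<in> \<A> \<Longrightarrow> \<phi> (X + Y) = \<phi> X + \<phi> Y"
  "X \<in> \<A> \<Longrightarrow> \<phi> (cscale c X) = cscale c (\<phi> X)"
  "X \<in> \<A> \<Longrightarrow> Y \<in> \<A> \<Longrightarrow> \<phi> (X ** Y) = \<phi> X ** \<phi> Y"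
  "X \<in> \<A> \<Longrightarrow> Y \<in> \<A> \<Longrightarrow> \<phi> (schur_product X Y) = schur_product (\<phi> X) (\<phi> Y)"
  "X \<in> \<A> \<Longrightarrow> \<phi> (conj_transpose X) = conj_transpose (\<phi> X)"
  and inj: "inj_on \<phi> \<A>" and surj: "\<phi> ` \<A> = \<B>"
  using iso unfolding coherent_algebra_iso_def bij_betw_def by blast+

lemma cscale_zero: "cscale 0 X = 0" by (simp add: vec_eq_iff)

lemma zero_mem: "0 \<in> \<A>" using closed(2)[OF closed(6), of 0] by (simp add: cscale_zero)

lemma \<phi>_zero: "\<phi> 0 = 0" using hom(2)[OF zero_mem, of 0] by (simp add: cscale_zero)

text \<open>A surjective multiplicative map sends the unit to the unit; \<open>\<phi>_ones\<close>
  is the same argument for the Schur product.\<close>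

lemma \<phi>_one: "\<phi> (mat 1) = mat 1"
proof -
  obtain X where X: "X \<in> \<A>" "\<phi> X = mat 1"
    using coherent_B surj by (auto simp: coherent_algebra_def image_iff)
  then show ?thesis using hom(3)[OF closed(6) X(1)] by simp
qed

lemma \<phi>_ones: "\<phi> all_ones = all_ones"
proof -
  have unit: "schur_product Y all_ones = Y" for Y :: "complex^'k^'k"
    by (simp add: schur_product_def all_ones_def vec_eq_iff)
  have unit': "schur_product all_ones Y = Y" for Y :: "complex^'k^'k"
    by (simp add: schur_product_def all_ones_def vec_eq_iff)
  obtain X where X: "X \<in> \<A>" "\<phi> X = all_ones"
    using coherent_B surj by (auto simp: coherent_algebra_def image_iff)
  then show ?thesis using hom(4)[OF closed(7) X(1)] by (simp add: unit unit')
qed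

lemma schur_product_nth: "schur_product X Y $ i $ j = X $ i $ j * Y $ i $ j"
  by (simp add: schur_product_def)

text \<open>Under the Schur product, \<phi> commutes with entrywise polynomials. These products
  serve as Lagrange numerators that vanish at prescribed vertex pairs.\<close>

lemma interpolation:
  assumes "finite I" "\<And>i. i \<in> I \<Longrightarrow> X i \<in> \<A>"
  obtains C where "C \<in> \<A>" "\<And>g g'. C $ g $ g' = (\<Prod>i\<in>I. X i $ g $ g' - c i)"
    "\<And>h h'. \<phi> C $ h $ h' = (\<Prod>i\<in>I. \<phi> (X i) $ h $ h' - c i)"
proof -
  have "\<exists>C\<in>\<A>. (\<forall>g g'. C $ g $ g' = (\<Prod>i\<in>I. X i $ g $ g' - c i)) \<and>
      (\<forall>h h'. \<phi> C $ h $ h' = (\<Prod>i\<in>I. \<phi> (X i) $ h $ h' - c i))"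
    using assms
  proof (induction I)
    case empty
    show ?case by (rule bexI[OF _ closed(7)]) (simp add: \<phi>_ones, simp add: all_ones_def)
  next
    case (insert i I)
    then obtain C where C: "C \<in> \<A>" "\<And>g g'. C $ g $ g' = (\<Prod>i\<in>I. X i $ g $ g' - c i)"
      "\<And>h h'. \<phi> C $ h $ h' = (\<Prod>i\<in>I. \<phi> (X i) $ h $ h' - c i)" by auto
    define d where "d = - c i"
    define Z where "Z = X i + cscale d all_ones"
    have Z: "Z \<in> \<A>" "\<phi> Z = \<phi> (X i) + cscale d all_ones"
      using hom(1,2) closed(1,2,7) insert.prems[of i] \<phi>_ones unfolding Z_def by simp_all
    show ?case
      by (rule bexI[OF _ closed(4)[OF Z(1) C(1)]])
        (use insert.hyps in \<open>simp add: hom Z C schur_product_nth, simp add: Z_def d_def all_ones_def\<close>)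
  qed
  then show ?thesis using that by blast
qed

text \<open>
  The colour of a pair of vertices is the corresponding entry as a character of the algebra; the
  colours on both sides are functions on \<open>\<A>\<close>, so that they can be compared.
\<close>
definition colour_A :: "'a \<Rightarrow> 'a \<Rightarrow> complex^'a^'a \<Rightarrow> complex" where
  "colour_A g g' X = (if X \<in> \<A> then X $ g $ g' else 0)"

definition colour_B :: "'b \<Rightarrow> 'b \<Rightarrow> complex^'a^'a \<Rightarrow> complex" where
  "colour_B h h' X = (if X \<in> \<A> then \<phi> X $ h $ h' else 0)"

lemma colour_eq_iff: "colour_A g g' = colour_B h h' \<longleftrightarrow> (\<forall>X\<in>\<A>. X $ g $ g' = \<phi> X $ h $ h')"
  by (auto simp: colour_A_def colour_B_def fun_eq_iff)

text \<open>Otherwise each pair \<open>p\<close> of \<open>G\<close> has a matrix separating it from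
  \<open>(h, h')\<close>. The product of these, shifted to vanish at their own \<open>p\<close>, is
  the zero matrix, yet its image is nonzero at \<open>(h, h')\<close>. In
  \<open>colour_A_match\<close> the roles are exchanged and injectivity of \<phi> is used.\<close>

lemma colour_B_match: "\<exists>g g'. colour_A g g' = colour_B h h'"
proof (rule ccontr)
  assume "\<not> ?thesis"
  then have "\<exists>X. X \<in> \<A> \<and> X $ fst p $ snd p \<noteq> \<phi> X $ h $ h'" for p
    by (auto simp: colour_eq_iff)
  then obtain X where X: "\<And>p. X p \<in> \<A>" "\<And>p. X p $ fst p $ snd p \<noteq> \<phi> (X p) $ h $ h'" by metis
  obtain C where C: "C \<in> \<A>" "\<And>g g'. C $ g $ g' = (\<Prod>p\<in>UNIV. X p $ g $ g' - X p $ fst p $ snd p)"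
    "\<phi> C $ h $ h' = (\<Prod>p\<in>UNIV. \<phi> (X p) $ h $ h' - X p $ fst p $ snd p)"
    by (rule interpolation[of UNIV X "\<lambda>p. X p $ fst p $ snd p"]) (use X(1) in \<open>auto\<close>)
  have "C $ g $ g' = 0" for g g'
    unfolding C(2) by (rule prod_zero) (auto intro: bexI[of _ "(g, g')"])
  then have "C = 0" by (simp add: vec_eq_iff)
  then have "\<phi> C $ h $ h' = 0" by (simp add: \<phi>_zero)
  then show False using X(2) unfolding C(3) by (auto simp: prod_zero_iff) metis
qed

lemma colour_A_match: "\<exists>h h'. colour_A g g' = colour_B h h'"
proof (rule ccontr)
  assume "\<not> ?thesis"
  then have "\<exists>X. X \<in> \<A> \<and> X $ g $ g' \<noteq> \<phi> X $ fst q $ snd q" for q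
    by (auto simp: colour_eq_iff)
  then obtain X where X: "\<And>q. X q \<in> \<A>" "\<And>q. X q $ g $ g' \<noteq> \<phi> (X q) $ fst q $ snd q" by metis
  obtain C where C: "C \<in> \<A>" "C $ g $ g' = (\<Prod>q\<in>UNIV. X q $ g $ g' - \<phi> (X q) $ fst q $ snd q)"
    "\<And>h h'. \<phi> C $ h $ h' = (\<Prod>q\<in>UNIV. \<phi> (X q) $ h $ h' - \<phi> (X q) $ fst q $ snd q)"
    by (rule interpolation[of UNIV X "\<lambda>q. \<phi> (X q) $ fst q $ snd q"]) (use X(1) in \<open>auto\<close>)
  have "\<phi> C $ h $ h' = 0" for h h'
    unfolding C(3) by (rule prod_zero) (auto intro: bexI[of _ "(h, h')"])
  then have "\<phi> C = \<phi> 0" by (simp add: vec_eq_iff \<phi>_zero)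
  then have "C = 0" using inj C(1) zero_mem by (simp add: inj_on_eq_iff)
  then show False using X(2) C(2) by (auto simp: prod_zero_iff)
qed

text \<open>Lagrange interpolation: the product vanishes at all pairs of other colours, and dividing
  by its value at \<open>(r, r')\<close> normalises it. On \<open>H\<close> the values are read off
  through \<open>colour_B_match\<close>.\<close>

lemma colour_class_indicator:
  obtains E where "E \<in> \<A>" "\<And>g g'. E $ g $ g' = (if colour_A g g' = colour_A r r' then 1 else 0)"
    "\<And>h h'. \<phi> E $ h $ h' = (if colour_B h h' = colour_A r r' then 1 else 0)"
proof -
  define I where "I = {p. colour_A (fst p) (snd p) \<noteq> colour_A r r'}"
  have "\<exists>X. X \<in> \<A> \<and> X $ r $ r' \<noteq> X $ fst p $ snd p" if "p \<in> I" for p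
    using that by (auto simp: I_def colour_A_def fun_eq_iff split: if_splits)
  then obtain X where X: "\<And>p. p \<in> I \<Longrightarrow> X p \<in> \<A>"
    "\<And>p. p \<in> I \<Longrightarrow> X p $ r $ r' \<noteq> X p $ fst p $ snd p" by metis
  obtain C where C: "C \<in> \<A>" "\<And>g g'. C $ g $ g' = (\<Prod>p\<in>I. X p $ g $ g' - X p $ fst p $ snd p)"
    by (rule interpolation[of I X "\<lambda>p. X p $ fst p $ snd p"]) (use X(1) in \<open>auto\<close>)
  define E where "E = cscale (1 / C $ r $ r') C"
  have E: "E \<in> \<A>" by (simp add: E_def closed C(1))
  have nz: "C $ r $ r' \<noteq> 0" using X(2) by (auto simp: C(2) prod_zero_iff)
  have EA: "E $ g $ g' = (if colour_A g g' = colour_A r r' then 1 else 0)" for g g'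
  proof (cases "colour_A g g' = colour_A r r'")
    case True
    then have "colour_A g g' C = colour_A r r' C" by simp
    then have "C $ g $ g' = C $ r $ r'" using C(1) by (simp add: colour_A_def)
    then show ?thesis using True nz by (simp add: E_def)
  next
    case False
    then have "C $ g $ g' = 0"
      unfolding C(2) by (intro prod_zero finite bexI[of _ "(g, g')"]) (simp_all add: I_def)
    then show ?thesis using False by (simp add: E_def)
  qed
  have EB: "\<phi> E $ h $ h' = (if colour_B h h' = colour_A r r' then 1 else 0)" for h h'
  proof -
    obtain g g' where g: "colour_A g g' = colour_B h h'" using colour_B_match by blast
    then have "\<phi> E $ h $ h' = E $ g $ g'" using E by (simp add: colour_eq_iff)
    then show ?thesis by (simp add: EA g)
  qed
  show ?thesis by (rule that[OF E EA EB])
qed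

text \<open>The count is an entry of the product of two class indicators, and \<phi> preserves
  products. A colour that does not occur in \<open>G\<close> does not occur in \<open>H\<close>
  either, so both sets are then empty.\<close>

lemma colour_count_match:
  assumes m: "colour_A g g' = colour_B h h'"
  shows "card {k. colour_A g k = i \<and> colour_A k g' = j} = card {l. colour_B h l = i \<and> colour_B l h' = j}"
proof (cases "(\<exists>r r'. i = colour_A r r') \<and> (\<exists>s s'. j = colour_A s s')")
  case True
  then obtain r r' s s' where ij: "i = colour_A r r'" "j = colour_A s s'" by blast
  obtain E where E: "E \<in> \<A>" "\<And>g g'. E $ g $ g' = (if colour_A g g' = i then 1 else 0)"
    "\<And>h h'. \<phi> E $ h $ h' = (if colour_B h h' = i then 1 else 0)"
    unfolding ij by (rule colour_class_indicator[of r r']) blast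
  obtain F where F: "F \<in> \<A>" "\<And>g g'. F $ g $ g' = (if colour_A g g' = j then 1 else 0)"
    "\<And>h h'. \<phi> F $ h $ h' = (if colour_B h h' = j then 1 else 0)"
    unfolding ij by (rule colour_class_indicator[of s s']) blast
  have "(E ** F) $ g $ g' = (\<Sum>k\<in>UNIV. if colour_A g k = i \<and> colour_A k g' = j then 1 else 0)"
    unfolding matrix_matrix_mult_def by (simp add: E F) (intro sum.cong, auto)
  then have 1: "(E ** F) $ g $ g' = of_nat (card {k. colour_A g k = i \<and> colour_A k g' = j})"
    by (simp add: sum.If_cases)
  have "(\<phi> E ** \<phi> F) $ h $ h' = (\<Sum>l\<in>UNIV. if colour_B h l = i \<and> colour_B l h' = j then 1 else 0)"
    unfolding matrix_matrix_mult_def by (simp add: E F) (intro sum.cong, auto)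
  then have 2: "\<phi> (E ** F) $ h $ h' = of_nat (card {l. colour_B h l = i \<and> colour_B l h' = j})"
    by (simp add: sum.If_cases hom E F)
  have "(E ** F) $ g $ g' = \<phi> (E ** F) $ h $ h'"
    using m closed(3)[OF E(1) F(1)] by (simp add: colour_eq_iff)
  then show ?thesis unfolding 1 2 by simp
next
  case False
  then have A: "{k. colour_A g k = i \<and> colour_A k g' = j} = {}" by blast
  have "\<exists>r r'. colour_B h h' = colour_A r r'" for h h' using colour_B_match[of h h'] by metis
  then have B: "{l. colour_B h l = i \<and> colour_B l h' = j} = {}" using False by blast
  show ?thesis unfolding A B by simp
qed

text \<open>Multiplying a class indicator by \<open>all_ones\<close> on both sides yields a constant
  matrix whose entries are the class size.\<close>

lemma colour_size_match:
  "card {p. colour_A (fst p) (snd p) = i} = card {q. colour_B (fst q) (snd q) = i}"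
proof (cases "\<exists>r r'. i = colour_A r r'")
  case True
  then obtain r r' where i: "i = colour_A r r'" by blast
  obtain E where E: "E \<in> \<A>" "\<And>g g'. E $ g $ g' = (if colour_A g g' = i then 1 else 0)"
    "\<And>h h'. \<phi> E $ h $ h' = (if colour_B h h' = i then 1 else 0)"
    unfolding i by (rule colour_class_indicator[of r r']) blast
  have JXJ: "(all_ones ** (X ** all_ones)) $ a $ b = (\<Sum>p\<in>UNIV. X $ fst p $ snd p)"
    for X :: "complex^'k^'k" and a b
    by (simp add: matrix_matrix_mult_def all_ones_def sum_pairs)
  have 1: "(all_ones ** (E ** all_ones)) $ a $ b = of_nat (card {p. colour_A (fst p) (snd p) = i})" for a b
    by (simp add: JXJ E sum.If_cases)
  have 2: "\<phi> (all_ones ** (E ** all_ones)) $ a $ b = of_nat (card {q. colour_B (fst q) (snd q) = i})" for a b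
    by (simp add: hom closed E(1) \<phi>_ones JXJ) (simp add: E sum.If_cases)
  obtain h h' where "colour_A r r' = colour_B h h'" using colour_A_match by blast
  then have "(all_ones ** (E ** all_ones)) $ r $ r' = \<phi> (all_ones ** (E ** all_ones)) $ h $ h'"
    using E(1) by (simp add: colour_eq_iff closed)
  then show ?thesis unfolding 1 2 by simp
next
  case False
  then have A: "{p. colour_A (fst p) (snd p) = i} = {}" by blast
  have "\<exists>r r'. colour_B h h' = colour_A r r'" for h h' using colour_B_match[of h h'] by metis
  then have B: "{q. colour_B (fst q) (snd q) = i} = {}" using False by blast
  show ?thesis unfolding A B by simp
qed

lemma colour_converse_match:
  assumes "colour_A g g' = colour_B h h'"
  shows "colour_A g' g = colour_B h' h"
  unfolding colour_eq_iff
proof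
  fix X assume "X \<in> \<A>"
  then have "conj_transpose X $ g $ g' = \<phi> (conj_transpose X) $ h $ h'"
    using assms closed(5) unfolding colour_eq_iff by blast
  then show "X $ g' $ g = \<phi> X $ h' $ h"
    unfolding hom(5)[OF \<open>X \<in> \<A>\<close>] by (simp add: conj_transpose_def transpose_def)
qed

lemma colour_rel_match:
  assumes adj: "adjacency_matrix G \<in> \<A>" "\<phi> (adjacency_matrix G) = adjacency_matrix H"
    and "colour_A g g' = colour_B h h'"
  shows "rel G g g' = rel H h h'"
proof -
  have "mat 1 $ g $ g' = (mat 1 :: complex^'b^'b) $ h $ h'"
    using assms(3) closed(6) \<phi>_one unfolding colour_eq_iff by metis
  then have "g = g' \<longleftrightarrow> h = h'" by (simp add: mat_def split: if_splits)
  moreover have "adjacency_matrix G $ g $ g' = adjacency_matrix H $ h $ h'"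
    using assms unfolding colour_eq_iff by metis
  then have "G g g' \<longleftrightarrow> H h h'" by (simp add: adjacency_matrix_def split: if_splits)
  ultimately show ?thesis by (simp add: rel_def)
qed

end

lemma equivalent_imp_dnn_isomorphic:
  assumes "graphs_equivalent G H"
  shows "dnn_isomorphic G H"
proof -
  obtain \<phi> where iso: "coherent_algebra_iso \<phi> (coherent_algebra_of G) (coherent_algebra_of H)"
    and adj: "\<phi> (adjacency_matrix G) = adjacency_matrix H"
    using assms by (auto simp: graphs_equivalent_def)
  interpret coherent_isomorphism \<phi> "coherent_algebra_of G" "coherent_algebra_of H"
    by unfold_locales (rule coherent_algebra_of_graph iso)+
  interpret colour_matching G H colour_A colour_B
    using colour_A_match colour_B_match colour_rel_match[OF adjacency_matrix_mem adj]
      colour_converse_match colour_count_match colour_size_match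
    by unfold_locales
  show ?thesis by (rule dnn_isomorphic)
qed

theorem theorem9p2:
  fixes G :: "'a::finite \<Rightarrow> 'a \<Rightarrow> bool" and H :: "'b::finite \<Rightarrow> 'b \<Rightarrow> bool"
  assumes "simple_graph G" and "simple_graph H"
  shows "(dnn_isomorphic G H \<longleftrightarrow> graphs_equivalent G H) \<and>
         (graphs_equivalent G H \<longleftrightarrow>
            schrijver_theta (iso_product G H) = real CARD('a) \<and> CARD('a) = CARD('b)) \<and>
         (schrijver_theta (iso_product G H) = real CARD('a) \<and> CARD('a) = CARD('b) \<longleftrightarrow>
            (\<exists>y. nonneg_lasserre_solution G H y))"
proof -
  have "dnn_isomorphic G H \<longleftrightarrow> graphs_equivalent G H"
    using assms dnn_isomorphic_imp_equivalent equivalent_imp_dnn_isomorphic by blast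
  moreover have "dnn_isomorphic G H \<longleftrightarrow>
      schrijver_theta (iso_product G H) = real CARD('a) \<and> CARD('a) = CARD('b)"
    using assms dnn_isomorphic_imp_theta theta_imp_dnn_isomorphic by metis
  moreover have "dnn_isomorphic G H \<longleftrightarrow> (\<exists>y. nonneg_lasserre_solution G H y)"
    using lasserre_imp_dnn_isomorphic dnn_isomorphism.lasserre_vector_solution
    by (metis dnn_isomorphic_iff)
  ultimately show ?thesis by simp
qed

end
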